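(* Let $k$ be a commutative unitary ring, $p,q$ units of $k$ with $pq\ne 1$, $\alpha$ a positive integer, $\epsilon_{ij}=\pm1$ for $1\le i<j\le\alpha$ with $\epsilon_{ii}=1$, $\epsilon_{ji}=\epsilon_{ij}$, and let $m,n\le\alpha$ be positive integers. Then $L_{p,q,\epsilon}(n,m,k)$ is an adequate basic $T$-Lie algebra.
   Context: **$T$-Lie algebras.** Let $k$ be a commutative unitary ring, $\mathbb{N}=\{1,2,\ldots\}$, and let $L$ be a free $k$-module with a given totally ordered basis $\mathcal{B}$; $\otimes$ means $\otimes_k$. Let $L^{3}\subseteq L^{\otimes 3}$ be the $k$-span of the $x\otimes y\otimes z$ with $x<y<z$ in $\mathcal{B}$, and ${}^{3}L$ the $k$-span of those with $x>y>z$ in $\mathcal{B}$. $L$ together with $k$-linear maps $S,T,\langle,\rangle:L\otimes L\to L\otimes L$ and $[,]:L\otimes L\to L$ is a *$T$-Lie algebra with basis $\mathcal{B}$* (a *basic $T$-Lie algebra* ) if, with $S_{12}=S\otimes Id$, $S_{23}=Id\otimes S$: 1. (a) $S^2=Id$; (b) for all $x,y\in\mathcal{B}$, $S(x\otimes y)=q_{x,y}\,y\otimes x$ for some $q_{x,y}\in k$; (c) $S(Id\otimes[,])|_{L^3}=([,]\otimes Id)S_{23}S_{12}|_{L^3}$ and $S([,]\otimes Id)|_{L^3}=(Id\otimes[,])S_{12}S_{23}|_{L^3}$. 2. There is a decomposition $L=\bigoplus_{\eta\in\mathbb{N}}L_\eta$ into $k$-submodules, with every element of $\mathcal{B}$ homogeneous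 (write $\eta(x)=\eta$ for $x\in L_\eta$), such that $[L_{\eta_1},L_{\eta_2}]\subseteq\bigoplus_{\eta\le\eta_1+\eta_2-1}L_\eta$ and $\langle L_{\eta_1}\otimes L_{\eta_2}\rangle\subseteq\bigoplus_{\alpha+\beta\le\eta_1+\eta_2-1}L_\alpha\otimes L_\beta$ for all $\eta_1,\eta_2$. 3. $T=S+\langle,\rangle$. 4. $[,]T=-[,]$; $\langle,\rangle S=-\langle,\rangle$; $[,]\langle,\rangle=0$. 5. $[,]\big((Id\otimes[,])S_{12}S_{23}-([,]\otimes Id)S_{23}S_{12}+(Id\otimes[,])S_{23}S_{12}\big)|_{{}^{3}L}=0$. **$L_{p,q,\epsilon}(n,m,k)$** is the free $k$-module with basis $\mathcal{B}=\{Z_i^j\mid 1\le i\le n,\ 1\le j\le m\}$, ordered by $Z_i^j>Z_u^v$ iff $i>u$, or $i=u$ and $j>v$. Its structure is: $[,]=0$; grading $\eta(Z_j^i)=j\,3^{i-1}$; $T=S+\langle,\rangle$; and for $Z_i^l>Z_u^v$: $$\langle Z_i^l,Z_u^v\rangle=\begin{cases}\epsilon_{vl}(p-q^{-1})\,Z_i^v\otimes Z_u^l&\text{if } i>u,\ l>v,\\0&\text{otherwise,}\end{cases}$$ $$S(Z_i^l\otimes Z_u^v)=\begin{cases}\epsilon_{vl}\,p\,Z_u^v\otimes Z_i^l& i=u,\ l>v,\\ \epsilon_{ui}\,q\,Z_u^v\otimes Z_i^l& l=v,\ i>u,\\ \epsilon_{iu}\epsilon_{vl}\,p^{-1}q\,Z_u^v\otimes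 Z_i^l& i>u,\ v>l,\\ \epsilon_{vl}\epsilon_{ui}\,Z_u^v\otimes Z_i^l& i>u,\ l>v.\end{cases}$$ For $x\in\mathcal{B}$, $S(x\otimes x)=x\otimes x$ and $\langle x,x\rangle=0$; for the remaining pairs $S$ and $\langle,\rangle$ are determined by $S^2=Id$ and $\langle,\rangle S=-\langle,\rangle$. **$q$-symmetric algebra.** For a basic $T$-Lie algebra $L$, $\mathcal{S}(L)$ is the tensor algebra of $L$ modulo the ideal generated by $x\otimes y-S(x\otimes y)$, $x,y\in\mathcal{B}$. Write $z_\lambda$ for the image of $x_\lambda\in\mathcal{B}$, and $z_\Sigma=z_{\lambda_1}\cdots z_{\lambda_u}$ for a sequence $\Sigma=(x_{\lambda_1}\le\cdots\le x_{\lambda_u})$ in $\mathcal{B}$ (in which $x$ may be repeated only if $q_{x,x}=1$), $z_\emptyset=1$. $\mathcal{S}(L)$ is a free $k$-module with basis the $z_\Sigma$. Put $\eta(\lambda)=\eta(x_\lambda)$, $\eta(\Sigma)=\sum_i\eta(x_{\lambda_i})$, $q_{\lambda\mu}=q_{x_\lambda,x_\mu}$, and write $x_\lambda\le\Sigma$ if $x_\lambda\le x_{\lambda_1}$ (or $\Sigma=\emptyset$). **The canonical map.** $\cdot:L\otimes\mathcal{S}(L)\to\mathcal{S}(L)$ is the $k$-linear map defined recursively on $\eta(\lambda)+\eta(\Sigma)$ by: $x_\lambda\cdot z_\Sigma=z_\lambda z_\Sigma$ if $x_\lambda\le\Sigma$; otherwise write $\Sigma=(x_\mu,N)$ with $x_\mu\le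 N$, $x_\lambda>x_\mu$, and put $$x_\lambda\cdot z_\Sigma=q_{\lambda\mu}z_\mu z_\lambda z_N+q_{\lambda\mu}\,x_\mu\cdot(x_\lambda\cdot z_N-z_\lambda z_N)+\langle x_\lambda,x_\mu\rangle\cdot z_N+[x_\lambda,x_\mu]\cdot z_N.$$ Here and below $(a\otimes b)\cdot z$ means $a\cdot(b\cdot z)$, and $a\cdot b\cdot z=a\cdot(b\cdot z)$. **Adequate.** $L$ is *adequate* if for every $r$ the following holds: if $$x_{\lambda'}\cdot x_{\mu'}\cdot z_M-T(x_{\lambda'}\otimes x_{\mu'})\cdot z_M=[x_{\lambda'},x_{\mu'}]\cdot z_M$$ for all $x_{\lambda'},x_{\mu'}\in\mathcal{B}$ and $M$ with $\eta(\lambda')+\eta(\mu')+\eta(M)\le r$, then $$\begin{aligned}&\langle x_\lambda,x_\mu\rangle\cdot x_\gamma\cdot z_N-q_{\lambda\mu}[x_\mu,[x_\lambda,x_\gamma]]\cdot z_N\\&=q_{\mu\gamma}q_{\lambda\gamma}\langle x_\gamma,[x_\lambda,x_\mu]\rangle\cdot z_N+q_{\mu\gamma}q_{\lambda\gamma}x_\gamma\cdot\langle x_\lambda,x_\mu\rangle\cdot z_N\\&\quad+q_{\mu\gamma}\langle x_\lambda,x_\gamma\rangle\cdot x_\mu\cdot z_N-q_{\lambda\mu}x_\mu\cdot\langle x_\lambda,x_\gamma\rangle\cdot z_N\\&\quad+q_{\mu\gamma}[x_\lambda,x_\gamma]\cdot x_\mu\cdot z_N-q_{\lambda\mu}x_\mu\cdot[x_\lambda,x_\gamma]\cdot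 z_N\\&\quad+x_\lambda\cdot\langle x_\mu,x_\gamma\rangle\cdot z_N-q_{\lambda\mu}q_{\lambda\gamma}\langle x_\mu,x_\gamma\rangle\cdot x_\lambda\cdot z_N-q_{\lambda\gamma}q_{\lambda\mu}\langle[x_\mu,x_\gamma],x_\lambda\rangle\cdot z_N\end{aligned}$$ for all $x_\lambda>x_\mu>x_\gamma$ in $\mathcal{B}$ and $N$ with $x_\gamma\le N$ and $\eta(\lambda)+\eta(\mu)+\eta(\gamma)+\eta(N)\le r+1$. *)

theory Defs
  imports Complex_Main "HOL-Library.Poly_Mapping" "HOL-Algebra.QuotRing"
begin

section \<open>Free modules and tensor products of free modules\<close>

text \<open>
  The free \<open>k\<close>-module on a set \<open>B\<close> of basis elements is realised as the finitely supported
  functions \<open>'b \<Rightarrow>\<^sub>0 'k\<close> with support in \<open>B\<close>.  For free modules \<open>L\<close>, \<open>M\<close> with bases \<open>B\<close>, \<open>C\<close> the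
  tensor product \<open>L \<otimes> M\<close> is the free module on \<open>B \<times> C\<close>; \<open>tens\<close> is the universal bilinear map.
  Triple tensor products are nested to the right.
\<close>

abbreviation bas :: "'b \<Rightarrow> ('b \<Rightarrow>\<^sub>0 'k::comm_ring_1)" where
  "bas x \<equiv> Poly_Mapping.single x 1"

definition scale :: "'k::comm_ring_1 \<Rightarrow> ('b \<Rightarrow>\<^sub>0 'k) \<Rightarrow> ('b \<Rightarrow>\<^sub>0 'k)" where
  "scale c f = Poly_Mapping.map ((*) c) f"

lemma lookup_scale [simp]: "Poly_Mapping.lookup (scale c f) x = c * Poly_Mapping.lookup f x"
  by (simp add: scale_def Poly_Mapping.map.rep_eq when_def)

interpretation free_mod: module "scale :: 'k::comm_ring_1 \<Rightarrow> ('b \<Rightarrow>\<^sub>0 'k) \<Rightarrow> ('b \<Rightarrow>\<^sub>0 'k)"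
  by unfold_locales (auto intro!: poly_mapping_eqI simp: lookup_add algebra_simps)

definition free_on :: "'b set \<Rightarrow> ('b \<Rightarrow>\<^sub>0 'k::comm_ring_1) set" where
  "free_on B = {f. Poly_Mapping.keys f \<subseteq> B}"

definition lin_ext ::
  "('a \<Rightarrow> ('b \<Rightarrow>\<^sub>0 'k::comm_ring_1)) \<Rightarrow> ('a \<Rightarrow>\<^sub>0 'k) \<Rightarrow> ('b \<Rightarrow>\<^sub>0 'k)" where
  "lin_ext g f = (\<Sum>x\<in>Poly_Mapping.keys f. scale (Poly_Mapping.lookup f x) (g x))"

definition linear_map_on ::
  "('a \<Rightarrow>\<^sub>0 'k::comm_ring_1) set \<Rightarrow> ('b \<Rightarrow>\<^sub>0 'k) set \<Rightarrow> (('a \<Rightarrow>\<^sub>0 'k) \<Rightarrow> ('b \<Rightarrow>\<^sub>0 'k)) \<Rightarrow> bool" where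
  "linear_map_on V W F \<longleftrightarrow>
     (\<forall>v\<in>V. F v \<in> W) \<and>
     (\<forall>u\<in>V. \<forall>v\<in>V. F (u + v) = F u + F v) \<and>
     (\<forall>c. \<forall>v\<in>V. F (scale c v) = scale c (F v))"

definition tens ::
  "('a \<Rightarrow>\<^sub>0 'k::comm_ring_1) \<Rightarrow> ('b \<Rightarrow>\<^sub>0 'k) \<Rightarrow> ('a \<times> 'b \<Rightarrow>\<^sub>0 'k)" where
  "tens u v = lin_ext (\<lambda>x. lin_ext (\<lambda>y. bas (x, y)) v) u"

definition map_tens ::
  "(('a \<Rightarrow>\<^sub>0 'k::comm_ring_1) \<Rightarrow> ('c \<Rightarrow>\<^sub>0 'k)) \<Rightarrow> (('b \<Rightarrow>\<^sub>0 'k) \<Rightarrow> ('d \<Rightarrow>\<^sub>0 'k)) \<Rightarrow>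
   ('a \<times> 'b \<Rightarrow>\<^sub>0 'k) \<Rightarrow> ('c \<times> 'd \<Rightarrow>\<^sub>0 'k)" where
  "map_tens F G = lin_ext (\<lambda>(x, y). tens (F (bas x)) (G (bas y)))"

definition tens_span ::
  "('a \<Rightarrow>\<^sub>0 'k::comm_ring_1) set \<Rightarrow> ('b \<Rightarrow>\<^sub>0 'k) set \<Rightarrow> ('a \<times> 'b \<Rightarrow>\<^sub>0 'k) set" where
  "tens_span V W = free_mod.span {tens v w | v w. v \<in> V \<and> w \<in> W}"

definition assoc_l :: "('a \<times> 'b \<times> 'c \<Rightarrow>\<^sub>0 'k::comm_ring_1) \<Rightarrow> (('a \<times> 'b) \<times> 'c \<Rightarrow>\<^sub>0 'k)" where
  "assoc_l = lin_ext (\<lambda>(x, y, z). bas ((x, y), z))"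

definition assoc_r :: "(('a \<times> 'b) \<times> 'c \<Rightarrow>\<^sub>0 'k::comm_ring_1) \<Rightarrow> ('a \<times> 'b \<times> 'c \<Rightarrow>\<^sub>0 'k)" where
  "assoc_r = lin_ext (\<lambda>((x, y), z). bas (x, y, z))"


section \<open>Basic T-Lie algebras\<close>

text \<open>
  The total order of the basis is that of the type class.  The fields \<open>tl_S\<close>, \<open>tl_T\<close>, \<open>tl_ang\<close>,
  \<open>tl_br\<close> are the maps \<open>S\<close>, \<open>T\<close>, \<open>\<langle>,\<rangle>\<close>, \<open>[,]\<close>; \<open>tl_comp \<eta>\<close>, for \<open>\<eta> \<ge> 1\<close>, is the submodule \<open>L\<^sub>\<eta>\<close>.
  The decomposition is part of the data because adequacy refers to the degrees \<open>\<eta>(x)\<close>.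
\<close>

record (overloaded) ('b, 'k) tlie =
  tl_basis :: "'b set"
  tl_comp :: "nat \<Rightarrow> ('b \<Rightarrow>\<^sub>0 'k) set"
  tl_S :: "('b \<times> 'b \<Rightarrow>\<^sub>0 'k) \<Rightarrow> ('b \<times> 'b \<Rightarrow>\<^sub>0 'k)"
  tl_T :: "('b \<times> 'b \<Rightarrow>\<^sub>0 'k) \<Rightarrow> ('b \<times> 'b \<Rightarrow>\<^sub>0 'k)"
  tl_ang :: "('b \<times> 'b \<Rightarrow>\<^sub>0 'k) \<Rightarrow> ('b \<times> 'b \<Rightarrow>\<^sub>0 'k)"
  tl_br :: "('b \<times> 'b \<Rightarrow>\<^sub>0 'k) \<Rightarrow> ('b \<Rightarrow>\<^sub>0 'k)"

definition direct_sum_decomp ::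
  "('b \<Rightarrow>\<^sub>0 'k::comm_ring_1) set \<Rightarrow> (nat \<Rightarrow> ('b \<Rightarrow>\<^sub>0 'k) set) \<Rightarrow> bool" where
  "direct_sum_decomp V C \<longleftrightarrow>
     (\<forall>\<eta>\<ge>1. free_mod.subspace (C \<eta>) \<and> C \<eta> \<subseteq> V) \<and>
     (\<forall>v\<in>V. \<exists>!c :: nat \<Rightarrow>\<^sub>0 ('b \<Rightarrow>\<^sub>0 'k).
        0 \<notin> Poly_Mapping.keys c \<and> (\<forall>\<eta>\<ge>1. Poly_Mapping.lookup c \<eta> \<in> C \<eta>) \<and>
        v = (\<Sum>\<eta>\<in>Poly_Mapping.keys c. Poly_Mapping.lookup c \<eta>))"

definition S12 ::
  "('b, 'k::comm_ring_1) tlie \<Rightarrow> ('b \<times> 'b \<times> 'b \<Rightarrow>\<^sub>0 'k) \<Rightarrow> ('b \<times> 'b \<times> 'b \<Rightarrow>\<^sub>0 'k)" where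
  "S12 L t = assoc_r (map_tens (tl_S L) (\<lambda>v. v) (assoc_l t))"

definition S23 ::
  "('b, 'k::comm_ring_1) tlie \<Rightarrow> ('b \<times> 'b \<times> 'b \<Rightarrow>\<^sub>0 'k) \<Rightarrow> ('b \<times> 'b \<times> 'b \<Rightarrow>\<^sub>0 'k)" where
  "S23 L = map_tens (\<lambda>v. v) (tl_S L)"

definition br_Id ::
  "('b, 'k::comm_ring_1) tlie \<Rightarrow> ('b \<times> 'b \<times> 'b \<Rightarrow>\<^sub>0 'k) \<Rightarrow> ('b \<times> 'b \<Rightarrow>\<^sub>0 'k)" where
  "br_Id L t = map_tens (tl_br L) (\<lambda>v. v) (assoc_l t)"

definition Id_br ::
  "('b, 'k::comm_ring_1) tlie \<Rightarrow> ('b \<times> 'b \<times> 'b \<Rightarrow>\<^sub>0 'k) \<Rightarrow> ('b \<times> 'b \<Rightarrow>\<^sub>0 'k)" where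
  "Id_br L = map_tens (\<lambda>v. v) (tl_br L)"

definition cube_inc :: "'b::linorder set \<Rightarrow> ('b \<times> 'b \<times> 'b \<Rightarrow>\<^sub>0 'k::comm_ring_1) set" where
  "cube_inc B = free_mod.span {bas (x, y, z) | x y z. x \<in> B \<and> y \<in> B \<and> z \<in> B \<and> x < y \<and> y < z}"

definition cube_dec :: "'b::linorder set \<Rightarrow> ('b \<times> 'b \<times> 'b \<Rightarrow>\<^sub>0 'k::comm_ring_1) set" where
  "cube_dec B = free_mod.span {bas (x, y, z) | x y z. x \<in> B \<and> y \<in> B \<and> z \<in> B \<and> x > y \<and> y > z}"

definition basic_T_Lie_algebra :: "('b::linorder, 'k::comm_ring_1) tlie \<Rightarrow> bool" where
  "basic_T_Lie_algebra L \<longleftrightarrow>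
    (let B = tl_basis L; V = free_on B; V2 = free_on (B \<times> B); C = tl_comp L;
         S = tl_S L; T = tl_T L; ang = tl_ang L; br = tl_br L
     in
      linear_map_on V2 V2 S \<and> linear_map_on V2 V2 T \<and>
      linear_map_on V2 V2 ang \<and> linear_map_on V2 V br \<and>
      (\<forall>t\<in>V2. S (S t) = t) \<and>
      (\<forall>x\<in>B. \<forall>y\<in>B. \<exists>q. S (bas (x, y)) = scale q (bas (y, x))) \<and>
      (\<forall>t\<in>cube_inc B. S (Id_br L t) = br_Id L (S23 L (S12 L t))) \<and>
      (\<forall>t\<in>cube_inc B. S (br_Id L t) = Id_br L (S12 L (S23 L t))) \<and>
      direct_sum_decomp V C \<and>
      (\<forall>x\<in>B. \<exists>\<eta>\<ge>1. bas x \<in> C \<eta>) \<and>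
      (\<forall>\<eta>1\<ge>1. \<forall>\<eta>2\<ge>1.
         br ` tens_span (C \<eta>1) (C \<eta>2) \<subseteq>
           free_mod.span (\<Union>{C \<eta> | \<eta>. 1 \<le> \<eta> \<and> \<eta> \<le> \<eta>1 + \<eta>2 - 1})) \<and>
      (\<forall>\<eta>1\<ge>1. \<forall>\<eta>2\<ge>1.
         ang ` tens_span (C \<eta>1) (C \<eta>2) \<subseteq>
           free_mod.span (\<Union>{tens_span (C \<alpha>) (C \<beta>) | \<alpha> \<beta>.
             1 \<le> \<alpha> \<and> 1 \<le> \<beta> \<and> \<alpha> + \<beta> \<le> \<eta>1 + \<eta>2 - 1})) \<and>
      (\<forall>t\<in>V2. T t = S t + ang t) \<and>
      (\<forall>t\<in>V2. br (T t) = - br t) \<and>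
      (\<forall>t\<in>V2. ang (S t) = - ang t) \<and>
      (\<forall>t\<in>V2. br (ang t) = 0) \<and>
      (\<forall>t\<in>cube_dec B.
         br (Id_br L (S12 L (S23 L t)) - br_Id L (S23 L (S12 L t)) + Id_br L (S23 L (S12 L t))) = 0))"

text \<open>The scalar \<open>q\<^bsub>x,y\<^esub>\<close> with \<open>S(x \<otimes> y) = q\<^bsub>x,y\<^esub> y \<otimes> x\<close>.\<close>

definition tl_q :: "('b, 'k::comm_ring_1) tlie \<Rightarrow> 'b \<Rightarrow> 'b \<Rightarrow> 'k" where
  "tl_q L x y = Poly_Mapping.lookup (tl_S L (bas (x, y))) (y, x)"

definition tl_eta :: "('b, 'k::comm_ring_1) tlie \<Rightarrow> 'b \<Rightarrow> nat" where
  "tl_eta L x = (THE \<eta>. 1 \<le> \<eta> \<and> bas x \<in> tl_comp L \<eta>)"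

definition tl_etas :: "('b, 'k::comm_ring_1) tlie \<Rightarrow> 'b list \<Rightarrow> nat" where
  "tl_etas L \<Sigma> = sum_list (map (tl_eta L) \<Sigma>)"


section \<open>The q-symmetric algebra\<close>

text \<open>
  The tensor algebra of the free module on \<open>B\<close> is the monoid algebra of the free monoid of words
  in \<open>B\<close>: with concatenation as (additively written) monoid operation on lists, its product is
  the product of the type \<open>'b list \<Rightarrow>\<^sub>0 'k\<close>.
\<close>

instantiation list :: (type) monoid_add
begin

definition zero_list :: "'a list" where "zero_list = []"

definition plus_list :: "'a list \<Rightarrow> 'a list \<Rightarrow> 'a list" where "plus_list u v = u @ v"

instance by standard (simp_all add: zero_list_def plus_list_def)

end

definition tensor_algebra :: "'b set \<Rightarrow> ('b list \<Rightarrow>\<^sub>0 'k::comm_ring_1) ring" where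
  "tensor_algebra B =
     \<lparr>carrier = free_on (lists B), mult = (*), one = 1, zero = 0, add = (+)\<rparr>"

definition word2 :: "('b \<times> 'b \<Rightarrow>\<^sub>0 'k::comm_ring_1) \<Rightarrow> ('b list \<Rightarrow>\<^sub>0 'k)" where
  "word2 = lin_ext (\<lambda>(x, y). bas [x, y])"

definition sym_ideal :: "('b, 'k::comm_ring_1) tlie \<Rightarrow> ('b list \<Rightarrow>\<^sub>0 'k) set" where
  "sym_ideal L = genideal (tensor_algebra (tl_basis L))
     {bas [x, y] - word2 (tl_S L (bas (x, y))) | x y. x \<in> tl_basis L \<and> y \<in> tl_basis L}"

definition sym_algebra :: "('b, 'k::comm_ring_1) tlie \<Rightarrow> ('b list \<Rightarrow>\<^sub>0 'k) set ring" where
  "sym_algebra L = tensor_algebra (tl_basis L) Quot sym_ideal L"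

definition sym_class ::
  "('b, 'k::comm_ring_1) tlie \<Rightarrow> ('b list \<Rightarrow>\<^sub>0 'k) \<Rightarrow> ('b list \<Rightarrow>\<^sub>0 'k) set" where
  "sym_class L f = sym_ideal L +>\<^bsub>tensor_algebra (tl_basis L)\<^esub> f"

text \<open>Scalars act on \<open>\<S>(L)\<close> through the image of \<open>k \<cdot> 1\<close>.\<close>

definition sym_scale ::
  "('b, 'k::comm_ring_1) tlie \<Rightarrow> 'k \<Rightarrow> ('b list \<Rightarrow>\<^sub>0 'k) set \<Rightarrow> ('b list \<Rightarrow>\<^sub>0 'k) set" where
  "sym_scale L c z = sym_class L (scale c 1) \<otimes>\<^bsub>sym_algebra L\<^esub> z"

definition sym_gen :: "('b, 'k::comm_ring_1) tlie \<Rightarrow> 'b \<Rightarrow> ('b list \<Rightarrow>\<^sub>0 'k) set" where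
  "sym_gen L x = sym_class L (bas [x])"

definition sym_mon :: "('b, 'k::comm_ring_1) tlie \<Rightarrow> 'b list \<Rightarrow> ('b list \<Rightarrow>\<^sub>0 'k) set" where
  "sym_mon L \<Sigma> = foldr (\<lambda>x z. sym_gen L x \<otimes>\<^bsub>sym_algebra L\<^esub> z) \<Sigma> \<one>\<^bsub>sym_algebra L\<^esub>"

definition ordered_seq :: "('b::linorder, 'k::comm_ring_1) tlie \<Rightarrow> 'b list \<Rightarrow> bool" where
  "ordered_seq L \<Sigma> \<longleftrightarrow> set \<Sigma> \<subseteq> tl_basis L \<and> sorted \<Sigma> \<and>
     (\<forall>x\<in>set \<Sigma>. count_list \<Sigma> x \<ge> 2 \<longrightarrow> tl_q L x x = 1)"

definition le_seq :: "'b::linorder \<Rightarrow> 'b list \<Rightarrow> bool" where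
  "le_seq x \<Sigma> \<longleftrightarrow> \<Sigma> = [] \<or> x \<le> hd \<Sigma>"


section \<open>The canonical map and adequacy\<close>

text \<open>\<open>act2\<close> is \<open>t \<cdot> z\<close> for \<open>t \<in> L \<otimes> L\<close>, the linear extension of \<open>(a \<otimes> b) \<cdot> z = a \<cdot> (b \<cdot> z)\<close>.\<close>

definition act2 ::
  "('b, 'k::comm_ring_1) tlie \<Rightarrow>
   (('b \<Rightarrow>\<^sub>0 'k) \<Rightarrow> ('b list \<Rightarrow>\<^sub>0 'k) set \<Rightarrow> ('b list \<Rightarrow>\<^sub>0 'k) set) \<Rightarrow>
   ('b \<times> 'b \<Rightarrow>\<^sub>0 'k) \<Rightarrow> ('b list \<Rightarrow>\<^sub>0 'k) set \<Rightarrow> ('b list \<Rightarrow>\<^sub>0 'k) set" where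
  "act2 L act t z =
     finsum (sym_algebra L)
       (\<lambda>(a, b). sym_scale L (Poly_Mapping.lookup t (a, b)) (act (bas a) (act (bas b) z)))
       (Poly_Mapping.keys t)"

text \<open>
  A linear map \<open>L \<otimes> \<S>(L) \<rightarrow> \<S>(L)\<close> is given as a bilinear map \<open>act\<close>.  For a basic
  T-Lie algebra the recursion determines \<open>act\<close> on \<open>L \<times> \<S>(L)\<close>, by induction on the degree.
  The variable \<open>l\<close> plays the role of the index \<open>\<lambda>\<close>, which is reserved syntax.
\<close>

definition canonical_map ::
  "('b::linorder, 'k::comm_ring_1) tlie \<Rightarrow>
   (('b \<Rightarrow>\<^sub>0 'k) \<Rightarrow> ('b list \<Rightarrow>\<^sub>0 'k) set \<Rightarrow> ('b list \<Rightarrow>\<^sub>0 'k) set) \<Rightarrow> bool" where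
  "canonical_map L act \<longleftrightarrow>
    (let B = tl_basis L; V = free_on B; R = sym_algebra L; q = tl_q L; sc = sym_scale L in
      (\<forall>a\<in>V. \<forall>z\<in>carrier R. act a z \<in> carrier R) \<and>
      (\<forall>a\<in>V. \<forall>b\<in>V. \<forall>z\<in>carrier R. act (a + b) z = act a z \<oplus>\<^bsub>R\<^esub> act b z) \<and>
      (\<forall>a\<in>V. \<forall>y\<in>carrier R. \<forall>z\<in>carrier R. act a (y \<oplus>\<^bsub>R\<^esub> z) = act a y \<oplus>\<^bsub>R\<^esub> act a z) \<and>
      (\<forall>c. \<forall>a\<in>V. \<forall>z\<in>carrier R. act (scale c a) z = sc c (act a z) \<and> act a (sc c z) = sc c (act a z)) \<and>
      (\<forall>l\<in>B. \<forall>\<Sigma>. ordered_seq L \<Sigma> \<and> le_seq l \<Sigma> \<longrightarrow>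
         act (bas l) (sym_mon L \<Sigma>) = sym_gen L l \<otimes>\<^bsub>R\<^esub> sym_mon L \<Sigma>) \<and>
      (\<forall>l\<in>B. \<forall>\<mu> N. ordered_seq L (\<mu> # N) \<and> l > \<mu> \<longrightarrow>
         act (bas l) (sym_mon L (\<mu> # N)) =
           sc (q l \<mu>) (sym_gen L \<mu> \<otimes>\<^bsub>R\<^esub> (sym_gen L l \<otimes>\<^bsub>R\<^esub> sym_mon L N))
           \<oplus>\<^bsub>R\<^esub> sc (q l \<mu>) (act (bas \<mu>)
                 (act (bas l) (sym_mon L N) \<ominus>\<^bsub>R\<^esub> sym_gen L l \<otimes>\<^bsub>R\<^esub> sym_mon L N))
           \<oplus>\<^bsub>R\<^esub> act2 L act (tl_ang L (bas (l, \<mu>))) (sym_mon L N)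
           \<oplus>\<^bsub>R\<^esub> act (tl_br L (bas (l, \<mu>))) (sym_mon L N)))"

definition adequate_for ::
  "('b::linorder, 'k::comm_ring_1) tlie \<Rightarrow>
   (('b \<Rightarrow>\<^sub>0 'k) \<Rightarrow> ('b list \<Rightarrow>\<^sub>0 'k) set \<Rightarrow> ('b list \<Rightarrow>\<^sub>0 'k) set) \<Rightarrow> bool" where
  "adequate_for L act \<longleftrightarrow>
    (let B = tl_basis L; R = sym_algebra L; q = tl_q L; sc = sym_scale L;
         \<eta> = tl_eta L; \<eta>s = tl_etas L; z = sym_mon L;
         x = (\<lambda>l. act (bas l));
         x2 = act2 L act;
         ang = (\<lambda>u v. tl_ang L (tens u v));
         br = (\<lambda>u v. tl_br L (tens u v))
     in
      \<forall>r.
        (\<forall>l'\<in>B. \<forall>\<mu>'\<in>B. \<forall>M. ordered_seq L M \<and> \<eta> l' + \<eta> \<mu>' + \<eta>s M \<le> r \<longrightarrow>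
           x l' (x \<mu>' (z M)) \<ominus>\<^bsub>R\<^esub> x2 (tl_T L (bas (l', \<mu>'))) (z M)
             = act (br (bas l') (bas \<mu>')) (z M))
        \<longrightarrow>
        (\<forall>l\<in>B. \<forall>\<mu>\<in>B. \<forall>\<gamma>\<in>B. \<forall>N.
           l > \<mu> \<and> \<mu> > \<gamma> \<and> ordered_seq L N \<and> le_seq \<gamma> N \<and>
           \<eta> l + \<eta> \<mu> + \<eta> \<gamma> + \<eta>s N \<le> r + 1 \<longrightarrow>
           x2 (ang (bas l) (bas \<mu>)) (x \<gamma> (z N))
             \<ominus>\<^bsub>R\<^esub> sc (q l \<mu>) (act (br (bas \<mu>) (br (bas l) (bas \<gamma>))) (z N))
           = sc (q \<mu> \<gamma> * q l \<gamma>) (x2 (ang (bas \<gamma>) (br (bas l) (bas \<mu>))) (z N))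
             \<oplus>\<^bsub>R\<^esub> sc (q \<mu> \<gamma> * q l \<gamma>) (x \<gamma> (x2 (ang (bas l) (bas \<mu>)) (z N)))
             \<oplus>\<^bsub>R\<^esub> sc (q \<mu> \<gamma>) (x2 (ang (bas l) (bas \<gamma>)) (x \<mu> (z N)))
             \<ominus>\<^bsub>R\<^esub> sc (q l \<mu>) (x \<mu> (x2 (ang (bas l) (bas \<gamma>)) (z N)))
             \<oplus>\<^bsub>R\<^esub> sc (q \<mu> \<gamma>) (act (br (bas l) (bas \<gamma>)) (x \<mu> (z N)))
             \<ominus>\<^bsub>R\<^esub> sc (q l \<mu>) (x \<mu> (act (br (bas l) (bas \<gamma>)) (z N)))
             \<oplus>\<^bsub>R\<^esub> x l (x2 (ang (bas \<mu>) (bas \<gamma>)) (z N))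
             \<ominus>\<^bsub>R\<^esub> sc (q l \<mu> * q l \<gamma>) (x2 (ang (bas \<mu>) (bas \<gamma>)) (x l (z N)))
             \<ominus>\<^bsub>R\<^esub> sc (q l \<gamma> * q l \<mu>) (x2 (ang (br (bas \<mu>) (bas \<gamma>)) (bas l)) (z N))))"

text \<open>
  The first conjunct records that the recursion for the canonical map has a solution, so that
  the second one is never vacuous.
\<close>

definition adequate :: "('b::linorder, 'k::comm_ring_1) tlie \<Rightarrow> bool" where
  "adequate L \<longleftrightarrow>
     (\<exists>act. canonical_map L act) \<and> (\<forall>act. canonical_map L act \<longrightarrow> adequate_for L act)"


section \<open>The algebras \<open>L\<^bsub>p,q,\<epsilon>\<^esub>(n,m,k)\<close>\<close>

text \<open>\<open>Z i j\<close> is the generator with lower index \<open>i\<close> and upper index \<open>j\<close>.\<close>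

datatype Zgen = Z nat nat

instantiation Zgen :: linorder
begin

definition less_Zgen :: "Zgen \<Rightarrow> Zgen \<Rightarrow> bool" where
  "less_Zgen x y = (case (x, y) of (Z u v, Z i j) \<Rightarrow> i > u \<or> (i = u \<and> j > v))"

definition less_eq_Zgen :: "Zgen \<Rightarrow> Zgen \<Rightarrow> bool" where
  "less_eq_Zgen x y \<longleftrightarrow> x < y \<or> x = (y :: Zgen)"

instance
  by standard (auto simp: less_eq_Zgen_def less_Zgen_def split: Zgen.splits)

end

definition unit_inv :: "'k::comm_ring_1 \<Rightarrow> 'k" where
  "unit_inv c = (THE d. c * d = 1)"

text \<open>
  \<open>q_gt\<close> and \<open>ang_gt\<close> are the data for \<open>x > y\<close>.  For \<open>x < y\<close>, \<open>S\<^sup>2 = Id\<close> forces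
  \<open>q\<^bsub>x,y\<^esub> = q\<^bsub>y,x\<^esub>\<^sup>-\<^sup>1\<close>, and \<open>\<langle>,\<rangle>S = -\<langle>,\<rangle>\<close> applied to \<open>y \<otimes> x\<close> forces
  \<open>\<langle>x,y\<rangle> = -q\<^bsub>y,x\<^esub>\<^sup>-\<^sup>1 \<langle>y,x\<rangle>\<close>.
\<close>

fun q_gt :: "'k::comm_ring_1 \<Rightarrow> 'k \<Rightarrow> (nat \<Rightarrow> nat \<Rightarrow> 'k) \<Rightarrow> Zgen \<Rightarrow> Zgen \<Rightarrow> 'k" where
  "q_gt p q \<epsilon> (Z i l) (Z u v) =
     (if i = u \<and> l > v then \<epsilon> v l * p
      else if l = v \<and> i > u then \<epsilon> u i * q
      else if i > u \<and> v > l then \<epsilon> i u * \<epsilon> v l * unit_inv p * q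
      else if i > u \<and> l > v then \<epsilon> v l * \<epsilon> u i
      else 0)"

fun ang_gt :: "'k::comm_ring_1 \<Rightarrow> 'k \<Rightarrow> (nat \<Rightarrow> nat \<Rightarrow> 'k) \<Rightarrow> Zgen \<Rightarrow> Zgen \<Rightarrow> (Zgen \<times> Zgen \<Rightarrow>\<^sub>0 'k)" where
  "ang_gt p q \<epsilon> (Z i l) (Z u v) =
     (if i > u \<and> l > v then scale (\<epsilon> v l * (p - unit_inv q)) (bas (Z i v, Z u l)) else 0)"

definition Lpq_q :: "'k::comm_ring_1 \<Rightarrow> 'k \<Rightarrow> (nat \<Rightarrow> nat \<Rightarrow> 'k) \<Rightarrow> Zgen \<Rightarrow> Zgen \<Rightarrow> 'k" where
  "Lpq_q p q \<epsilon> x y =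
     (if x > y then q_gt p q \<epsilon> x y else if x = y then 1 else unit_inv (q_gt p q \<epsilon> y x))"

definition Lpq_S ::
  "'k::comm_ring_1 \<Rightarrow> 'k \<Rightarrow> (nat \<Rightarrow> nat \<Rightarrow> 'k) \<Rightarrow> (Zgen \<times> Zgen \<Rightarrow>\<^sub>0 'k) \<Rightarrow> (Zgen \<times> Zgen \<Rightarrow>\<^sub>0 'k)" where
  "Lpq_S p q \<epsilon> = lin_ext (\<lambda>(x, y). scale (Lpq_q p q \<epsilon> x y) (bas (y, x)))"

definition Lpq_ang ::
  "'k::comm_ring_1 \<Rightarrow> 'k \<Rightarrow> (nat \<Rightarrow> nat \<Rightarrow> 'k) \<Rightarrow> (Zgen \<times> Zgen \<Rightarrow>\<^sub>0 'k) \<Rightarrow> (Zgen \<times> Zgen \<Rightarrow>\<^sub>0 'k)" where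
  "Lpq_ang p q \<epsilon> = lin_ext (\<lambda>(x, y).
     if x > y then ang_gt p q \<epsilon> x y
     else if x = y then 0
     else - scale (unit_inv (q_gt p q \<epsilon> y x)) (ang_gt p q \<epsilon> y x))"

text \<open>In the grading \<open>\<eta>(Z\<^sub>j\<^sup>i) = j 3\<^bsup>i-1\<^esup>\<close> the index \<open>j\<close> is the lower one.\<close>

definition Lpq :: "'k::comm_ring_1 \<Rightarrow> 'k \<Rightarrow> (nat \<Rightarrow> nat \<Rightarrow> 'k) \<Rightarrow> nat \<Rightarrow> nat \<Rightarrow> (Zgen, 'k) tlie" where
  "Lpq p q \<epsilon> n m =
     \<lparr>tl_basis = {Z i j | i j. 1 \<le> i \<and> i \<le> n \<and> 1 \<le> j \<and> j \<le> m},
      tl_comp = (\<lambda>\<eta>. free_on {Z j i | i j. 1 \<le> j \<and> j \<le> n \<and> 1 \<le> i \<and> i \<le> m \<and> j * 3 ^ (i - 1) = \<eta>}),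
      tl_S = Lpq_S p q \<epsilon>,
      tl_T = (\<lambda>t. Lpq_S p q \<epsilon> t + Lpq_ang p q \<epsilon> t),
      tl_ang = Lpq_ang p q \<epsilon>,
      tl_br = (\<lambda>t. 0)\<rparr>"

end

theory Submission
  imports Defs "HOL-Library.Multiset"
begin

text \<open>
  Sorting words, with the product of the \<open>q\<^bsub>x,y\<^esub>\<close> over the inversions as coefficient, is a linear map
  whose kernel is the ideal defining \<open>\<S>(L)\<close>.  Hence \<open>\<S>(L)\<close> has the sorted words as a basis, and the
  canonical map becomes a recursion for functions with values in the free module on sorted words.
  Since \<open>\<langle>,\<rangle>\<close> lowers the degree, \<open>x\<^sub>l \<cdot> z\<^sub>w\<close> is \<open>z\<^sub>l z\<^sub>w\<close> up to terms of lower degree, and the recursion is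
  well founded.  For the same reason every product of three generators in the identity of adequacy
  has degree at most \<open>r\<close> together with \<open>z\<^sub>N\<close>, so the hypothesis allows to sort these products.  Comparing the
  coefficients of the sorted products in each relative position of the six indices proves the
  identity.
\<close>

section \<open>Linear extensions\<close>

text \<open>The identity of adequacy equates two ways of sorting \<open>x_l x_m x_g\<close>, one
  starting with the left pair and one with the right pair: both lead to the same multiple of
  \<open>x_g x_m x_l\<close>, and the terms with one angle bracket that arise on the way are what
  the identity compares. It cannot be obtained by sorting \<open>x_l x_m x_g\<close> itself, since
  this word together with \<open>z_N\<close> may have degree \<open>r + 1\<close>, one more than the
  hypothesis covers. Hence the bracket terms have to be compared directly. That they stay within
  reach is due to the weights i 3^(j-1): an angle bracket exchanges two upper indices, and the
  difference of the degrees is a product of two positive factors.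

  Adequacy is moreover stated in a quotient ring and for an arbitrary solution of the recursion.
  Reading off the coefficient of one fixed sorted word turns the identity into one in
  \<open>k\<close>, with an unknown scalar for each product of three generators. Only then can it be
  settled by commutative rewriting.\<close>

lemma scale_single: "scale c (Poly_Mapping.single x d) = Poly_Mapping.single x (c * d)"
  by (rule poly_mapping_eqI) (simp add: lookup_single when_def)

lemma scale_bas [simp]: "scale c (bas x) = Poly_Mapping.single x c"
  by (simp add: scale_single)

lemma lin_ext_superset:
  assumes "finite A" "Poly_Mapping.keys f \<subseteq> A"
  shows "lin_ext g f = (\<Sum>x\<in>A. scale (Poly_Mapping.lookup f x) (g x))"
  unfolding lin_ext_def using assms
  by (intro sum.mono_neutral_left) (auto simp: in_keys_iff)

lemma lin_ext_add: "lin_ext g (f + h) = lin_ext g f + lin_ext g h"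
proof -
  let ?A = "Poly_Mapping.keys f \<union> Poly_Mapping.keys h"
  have "lin_ext g (f + h) = (\<Sum>x\<in>?A. scale (Poly_Mapping.lookup (f + h) x) (g x))"
    using Poly_Mapping.keys_add[of f h] by (intro lin_ext_superset) auto
  also have "\<dots> = lin_ext g f + lin_ext g h"
    by (simp add: lin_ext_superset[of ?A] lookup_add free_mod.scale_left_distrib sum.distrib)
  finally show ?thesis .
qed

lemma keys_scale: "Poly_Mapping.keys (scale c f) \<subseteq> Poly_Mapping.keys f"
  by (auto simp: in_keys_iff)

lemma lin_ext_scale: "lin_ext g (scale c f) = scale c (lin_ext g f)"
  using lin_ext_superset[of "Poly_Mapping.keys f" "scale c f" g]
  by (simp add: keys_scale lin_ext_def free_mod.scale_sum_right)

lemma lin_ext_fun_add: "lin_ext (\<lambda>x. g x + h x) f = lin_ext g f + lin_ext h f"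
  by (simp add: lin_ext_def free_mod.scale_right_distrib sum.distrib)

lemma lin_ext_zero [simp]: "lin_ext g 0 = 0"
  by (simp add: lin_ext_def)

lemma lin_ext_bas [simp]: "lin_ext g (bas x) = g x"
  using lin_ext_superset[of "{x}" "bas x" g] by simp

lemma lin_ext_single: "lin_ext g (Poly_Mapping.single x c) = scale c (g x)"
  using lin_ext_scale[of g c "bas x"] by simp

lemma lin_ext_uminus: "lin_ext g (- f) = - lin_ext g f"
  using lin_ext_add[of g f "- f"] by (simp add: minus_unique)

lemma lin_ext_diff: "lin_ext g (f - h) = lin_ext g f - lin_ext g h"
  using lin_ext_add[of g f "- h"] by (simp add: lin_ext_uminus)

lemma lin_ext_sum: "lin_ext g (sum h A) = (\<Sum>a\<in>A. lin_ext g (h a))"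
  by (induction A rule: infinite_finite_induct) (auto simp: lin_ext_add)

lemma lin_ext_id [simp]: "lin_ext bas f = f"
  by (rule poly_mapping_eqI)
    (simp add: lin_ext_def lookup_sum lookup_single when_def in_keys_iff)

lemma lin_ext_cong:
  "(\<And>x. x \<in> Poly_Mapping.keys f \<Longrightarrow> g x = h x) \<Longrightarrow> lin_ext g f = lin_ext h f"
  by (simp add: lin_ext_def)

lemma lin_ext_comp: "lin_ext g (lin_ext h f) = lin_ext (\<lambda>x. lin_ext g (h x)) f"
  by (simp add: lin_ext_def[of h] lin_ext_def[of "\<lambda>x. lin_ext g (h x)"] lin_ext_sum lin_ext_scale)

text \<open>The interchange of two finite sums; it shows that an operator given by linear extension
  in a tensor \<open>t\<close> is also linear in the element on which it acts.\<close>

lemma lin_ext_swap: "lin_ext (\<lambda>x. lin_ext (g x) f) t = lin_ext (\<lambda>y. lin_ext (\<lambda>x. g x y) t) f"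
  unfolding lin_ext_def
  by (simp add: free_mod.scale_sum_right) (subst sum.swap, simp add: mult.commute)

lemma free_onD: "f \<in> free_on B \<Longrightarrow> x \<in> Poly_Mapping.keys f \<Longrightarrow> x \<in> B"
  by (auto simp: free_on_def)

lemma free_on_zero [simp]: "0 \<in> free_on B"
  by (simp add: free_on_def)

lemma free_on_bas [simp]: "x \<in> B \<Longrightarrow> Poly_Mapping.single x c \<in> free_on B"
  by (auto simp: free_on_def)

lemma free_on_word [simp]: "set w \<subseteq> B \<Longrightarrow> Poly_Mapping.single w c \<in> free_on (lists B)"
  by (auto simp: free_on_def)

lemma free_on_add: "f \<in> free_on B \<Longrightarrow> g \<in> free_on B \<Longrightarrow> f + g \<in> free_on B"
  using Poly_Mapping.keys_add[of f g] by (auto simp: free_on_def)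

lemma free_on_scale: "f \<in> free_on B \<Longrightarrow> scale c f \<in> free_on B"
  using keys_scale[of c f] by (auto simp: free_on_def)

lemma free_on_uminus: "f \<in> free_on B \<Longrightarrow> - f \<in> free_on B"
  by (auto simp: free_on_def)

lemma free_on_diff: "f \<in> free_on B \<Longrightarrow> g \<in> free_on B \<Longrightarrow> f - g \<in> free_on B"
  using free_on_add[of f B "- g"] by (simp add: free_on_uminus)

lemma free_on_sum: "(\<And>a. a \<in> A \<Longrightarrow> h a \<in> free_on B) \<Longrightarrow> sum h A \<in> free_on B"
  by (induction A rule: infinite_finite_induct) (auto simp: free_on_add)

lemma free_on_mono: "f \<in> free_on A \<Longrightarrow> A \<subseteq> B \<Longrightarrow> f \<in> free_on B"
  by (auto simp: free_on_def)

lemma lin_ext_free_on: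
  "f \<in> free_on B \<Longrightarrow> (\<And>x. x \<in> B \<Longrightarrow> g x \<in> free_on C) \<Longrightarrow> lin_ext g f \<in> free_on C"
  unfolding lin_ext_def by (intro free_on_sum free_on_scale) (auto dest: free_onD)

lemma free_on_subspace: "free_mod.subspace (free_on B)"
  by (simp add: free_mod.subspace_def free_on_add free_on_scale)

section \<open>Scalars and products in monoid algebras\<close>

lemma scale_eq_mult: "scale c f = Poly_Mapping.single 0 c * f" "scale c f = f * Poly_Mapping.single 0 c"
  for f :: "'a::monoid_add \<Rightarrow>\<^sub>0 'k::comm_ring_1"
proof -
  have f: "f = (\<Sum>x\<in>Poly_Mapping.keys f. Poly_Mapping.single x (Poly_Mapping.lookup f x))"
    using lin_ext_id[of f, symmetric] unfolding lin_ext_def by simp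
  show "scale c f = Poly_Mapping.single 0 c * f"
    by (subst (1 2) f) (simp add: free_mod.scale_sum_right sum_distrib_left mult_single scale_single)
  show "scale c f = f * Poly_Mapping.single 0 c"
    by (subst (1 2) f) (simp add: free_mod.scale_sum_right sum_distrib_right mult_single scale_single mult.commute)
qed

lemma scale_mult: "scale c f * g = scale c (f * g)" "f * scale c g = scale c (f * g)"
  for f g :: "'a::monoid_add \<Rightarrow>\<^sub>0 'k::comm_ring_1"
proof -
  show "scale c f * g = scale c (f * g)" by (simp add: scale_eq_mult(1) mult.assoc)
  show "f * scale c g = scale c (f * g)" by (simp add: scale_eq_mult(2) mult.assoc)
qed

text \<open>With the product written as an iterated linear extension, identities between linear maps
  on the tensor algebra reduce to words.\<close>

lemma mult_eq_lin_ext: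
  "f * g = lin_ext (\<lambda>u. lin_ext (\<lambda>v. bas (u + v)) g) f" for f g :: "'a::monoid_add \<Rightarrow>\<^sub>0 'k::comm_ring_1"
proof -
  have 1: "bas u * g = lin_ext (\<lambda>v. bas (u + v)) g" for u
    by (subst (1) lin_ext_id[of g, symmetric], unfold lin_ext_def)
      (simp add: sum_distrib_left scale_mult mult_single del: scale_bas)
  have "f * g = lin_ext bas f * g" by simp
  also have "\<dots> = lin_ext (\<lambda>u. bas u * g) f"
    unfolding lin_ext_def by (simp add: sum_distrib_right scale_mult del: scale_bas)
  finally show ?thesis by (simp add: 1)
qed

lemma free_on_mult:
  fixes f g :: "'b list \<Rightarrow>\<^sub>0 'k::comm_ring_1"
  assumes "f \<in> free_on (lists B)" "g \<in> free_on (lists B)"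
  shows "f * g \<in> free_on (lists B)"
  unfolding mult_eq_lin_ext using assms
  by (intro lin_ext_free_on[of _ "lists B"]) (auto simp: plus_list_def)

lemma bas_mult_bas: "bas u * bas v = (bas (u @ v) :: 'b list \<Rightarrow>\<^sub>0 'k::comm_ring_1)"
  by (simp add: mult_single plus_list_def)

lemma one_eq_bas: "(1 :: 'b list \<Rightarrow>\<^sub>0 'k::comm_ring_1) = bas []"
  by (simp flip: zero_list_def)

lemma one_free_on [simp]: "(1 :: 'b list \<Rightarrow>\<^sub>0 'k::comm_ring_1) \<in> free_on (lists B)"
  by (simp add: one_eq_bas)

lemma scale_lin_ext: "scale c (lin_ext g f) = lin_ext (\<lambda>x. scale c (g x)) f"
  by (simp add: lin_ext_def free_mod.scale_sum_right mult.commute)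

lemma linear_map_on_lin_ext:
  "(\<And>x. x \<in> B \<Longrightarrow> g x \<in> free_on C) \<Longrightarrow> linear_map_on (free_on B) (free_on C) (lin_ext g)"
  by (auto simp: linear_map_on_def lin_ext_add lin_ext_scale intro: lin_ext_free_on)

section \<open>Normal forms in the q-symmetric algebra\<close>

lemma ring_tensor_algebra: "ring (tensor_algebra B :: ('b list \<Rightarrow>\<^sub>0 'k::comm_ring_1) ring)"
proof (rule ringI)
  show "abelian_group (tensor_algebra B :: ('b list \<Rightarrow>\<^sub>0 'k) ring)"
  proof (rule abelian_groupI)
    fix x assume "x \<in> carrier (tensor_algebra B :: ('b list \<Rightarrow>\<^sub>0 'k) ring)"
    then show "\<exists>y\<in>carrier (tensor_algebra B). y \<oplus>\<^bsub>tensor_algebra B\<^esub> x = \<zero>\<^bsub>tensor_algebra B\<^esub>"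
      by (intro bexI[of _ "- x"]) (auto simp: tensor_algebra_def free_on_uminus)
  qed (auto simp: tensor_algebra_def free_on_add add_ac)
  show "monoid (tensor_algebra B :: ('b list \<Rightarrow>\<^sub>0 'k) ring)"
    by (rule monoidI) (auto simp: tensor_algebra_def free_on_mult mult.assoc)
qed (auto simp: tensor_algebra_def distrib_left distrib_right)

lemma tensor_algebra_simps [simp]:
  "carrier (tensor_algebra B) = free_on (lists B)"
  "monoid.mult (tensor_algebra B) = (*)" "one (tensor_algebra B) = 1"
  "zero (tensor_algebra B) = 0" "ring.add (tensor_algebra B) = (+)"
  by (simp_all add: tensor_algebra_def)

lemma tensor_algebra_minus:
  assumes "f \<in> free_on (lists B)" "g \<in> free_on (lists B)"
  shows "f \<ominus>\<^bsub>tensor_algebra B\<^esub> g = f - (g :: 'b list \<Rightarrow>\<^sub>0 'k::comm_ring_1)"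
proof -
  interpret T: ring "tensor_algebra B :: ('b list \<Rightarrow>\<^sub>0 'k) ring" by (rule ring_tensor_algebra)
  have "\<ominus>\<^bsub>tensor_algebra B\<^esub> g = - g"
    using assms by (intro T.minus_equality) (auto simp: free_on_uminus)
  then show ?thesis by (simp add: a_minus_def)
qed

section \<open>Sorting words with coefficients\<close>

lemma prod_list_mset_cong:
  "mset xs = mset ys \<Longrightarrow> prod_list (map f xs) = (prod_list (map f ys) :: 'k::comm_monoid_mult)"
  by (metis mset_map prod_mset_prod_list)

text \<open>The setting of quantum affine spaces: \<open>S\<close> is a flip with scalars. The
  condition \<open>q_self\<close> lets every letter repeat, so that all sorted words index the
  basis.\<close>

locale q_commutative =
  fixes L :: "('b::linorder, 'k::comm_ring_1) tlie"
  assumes S_bas: "x \<in> tl_basis L \<Longrightarrow> y \<in> tl_basis L \<Longrightarrow> tl_S L (bas (x, y)) = scale (tl_q L x y) (bas (y, x))"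
    and q_self: "x \<in> tl_basis L \<Longrightarrow> tl_q L x x = 1"
    and q_inverse: "x \<in> tl_basis L \<Longrightarrow> y \<in> tl_basis L \<Longrightarrow> tl_q L x y * tl_q L y x = 1"
begin

abbreviation "B \<equiv> tl_basis L"
abbreviation "q \<equiv> tl_q L"

definition cross :: "'b \<Rightarrow> 'b \<Rightarrow> 'k" where
  "cross x y = (if y < x then q x y else 1)"

definition crossl :: "'b \<Rightarrow> 'b list \<Rightarrow> 'k" where
  "crossl x w = prod_list (map (cross x) w)"

primrec sort_coeff :: "'b list \<Rightarrow> 'k" where
  "sort_coeff [] = 1"
| "sort_coeff (x # w) = crossl x w * sort_coeff w"

definition nf :: "('b list \<Rightarrow>\<^sub>0 'k) \<Rightarrow> ('b list \<Rightarrow>\<^sub>0 'k)" where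
  "nf = lin_ext (\<lambda>w. scale (sort_coeff w) (bas (sort w)))"

lemma nf_single: "nf (Poly_Mapping.single w c) = Poly_Mapping.single (sort w) (c * sort_coeff w)"
  by (simp add: nf_def lin_ext_single scale_single)

lemma nf_add: "nf (f + g) = nf f + nf g"
  and nf_diff: "nf (f - g) = nf f - nf g"
  and nf_zero [simp]: "nf 0 = 0"
  and nf_uminus: "nf (- f) = - nf f"
  by (simp_all add: nf_def lin_ext_add lin_ext_diff lin_ext_uminus)

lemma crossl_simps [simp]:
  "crossl x [] = 1" "crossl x (y # w) = cross x y * crossl x w" "crossl x (u @ v) = crossl x u * crossl x v"
  by (simp_all add: crossl_def)

lemma crossl_mset: "mset u = mset v \<Longrightarrow> crossl x u = crossl x v"
  unfolding crossl_def by (rule prod_list_mset_cong)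

lemma crossl_sort [simp]: "crossl x (sort w) = crossl x w"
  by (rule crossl_mset) simp

lemma crossl_le: "(\<And>y. y \<in> set w \<Longrightarrow> x \<le> y) \<Longrightarrow> crossl x w = 1"
  by (induction w) (auto simp: cross_def not_less[symmetric])

lemma sort_coeff_sorted: "sorted w \<Longrightarrow> sort_coeff w = 1"
  by (induction w) (auto simp: crossl_le)

text \<open>An inversion of \<open>u @ v\<close> lies in \<open>u\<close>, lies in \<open>v\<close>,
  or pairs a letter of \<open>u\<close> with one of \<open>v\<close>. The factor of the third kind
  depends only on the two multisets of letters.\<close>

lemma sort_coeff_append:
  "sort_coeff (u @ v) = sort_coeff u * prod_list (map (\<lambda>x. crossl x v) u) * sort_coeff v"
  by (induction u) (auto simp: mult_ac)

lemma sort_append_sort: "sort (sort u @ sort v) = sort (u @ v)"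
  by (rule properties_for_sort) auto

lemma nf_nf [simp]: "nf (nf f) = nf f"
  by (simp add: nf_def lin_ext_comp lin_ext_scale lin_ext_single sort_coeff_sorted scale_single sorted_sort_id)

lemma prod_crossl_sort: "prod_list (map (\<lambda>x. crossl x v) (sort u)) = prod_list (map (\<lambda>x. crossl x v) u)"
  by (rule prod_list_mset_cong) simp

text \<open>Sorting the factors beforehand accounts for the inversions inside each of them and
  leaves those between them unchanged. This makes the kernel of \<open>nf\<close> a two-sided ideal
  and takes the place of a confluence argument.\<close>

lemma nf_mult: "nf (nf f * nf g) = nf (f * g)"
  by (simp add: nf_def mult_eq_lin_ext lin_ext_comp lin_ext_single lin_ext_scale scale_lin_ext plus_list_def
      sort_append_sort sort_coeff_append sort_coeff_sorted prod_crossl_sort scale_single mult_ac)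

text \<open>For \<open>x < y\<close> the factor \<open>q x y\<close> cancels against the
  \<open>q y x\<close> that comes from sorting \<open>[y, x]\<close>.\<close>

lemma nf_swap:
  assumes "x \<in> B" "y \<in> B"
  shows "nf (bas [x, y]) = nf (scale (q x y) (bas [y, x]))"
proof -
  have "sort [x, y] = sort [y, x]" by (rule properties_for_sort) auto
  then show ?thesis using assms q_self[of x] q_inverse[of x y]
    by (cases x y rule: linorder_cases) (auto simp: nf_single cross_def)
qed

lemma word2_S: "x \<in> B \<Longrightarrow> y \<in> B \<Longrightarrow> word2 (tl_S L (bas (x, y))) = scale (q x y) (bas [y, x])"
  by (simp add: S_bas word2_def lin_ext_scale lin_ext_single del: scale_bas)

lemma nf_free_on: "f \<in> free_on (lists B) \<Longrightarrow> nf f \<in> free_on {w. set w \<subseteq> B \<and> sorted w}"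
  unfolding nf_def by (rule lin_ext_free_on[of _ "lists B"]) (auto simp: subset_iff)

section \<open>The defining ideal as the kernel of sorting\<close>

sublocale T: ring "tensor_algebra B :: ('b list \<Rightarrow>\<^sub>0 'k) ring"
  by (rule ring_tensor_algebra)

lemma sym_ideal_gens:
  "{bas [x, y] - word2 (tl_S L (bas (x, y))) | x y. x \<in> B \<and> y \<in> B} \<subseteq> free_on (lists B)"
  by (auto simp: word2_S simp del: scale_bas intro!: free_on_diff free_on_scale)

sublocale I: ideal "sym_ideal L" "tensor_algebra B"
  unfolding sym_ideal_def using sym_ideal_gens by (intro T.genideal_ideal) simp

lemma kernel_nf_ideal: "ideal {f \<in> free_on (lists B). nf f = 0} (tensor_algebra B)"
proof (rule idealI)
  have eq: "\<ominus>\<^bsub>tensor_algebra B\<^esub> f = - f" if "f \<in> free_on (lists B)" for f :: "'b list \<Rightarrow>\<^sub>0 'k"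
    using that by (intro T.minus_equality) (auto simp: free_on_uminus)
  show "subgroup {f \<in> free_on (lists B). nf f = 0} (add_monoid (tensor_algebra B))"
  proof (rule subgroup.intro)
    fix f :: "'b list \<Rightarrow>\<^sub>0 'k" assume f: "f \<in> {f \<in> free_on (lists B). nf f = 0}"
    then show "inv\<^bsub>add_monoid (tensor_algebra B)\<^esub> f \<in> {f \<in> free_on (lists B). nf f = 0}"
      using eq[of f] unfolding a_inv_def by (auto simp: free_on_uminus nf_uminus)
  qed (auto simp: free_on_add nf_add)
next
  fix f g :: "'b list \<Rightarrow>\<^sub>0 'k" assume fg: "f \<in> {f \<in> free_on (lists B). nf f = 0}" "g \<in> carrier (tensor_algebra B)"
  have "nf (g * f) = nf (nf g * nf f)" "nf (f * g) = nf (nf f * nf g)" by (simp_all add: nf_mult)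
  with fg show "g \<otimes>\<^bsub>tensor_algebra B\<^esub> f \<in> {f \<in> free_on (lists B). nf f = 0}"
    "f \<otimes>\<^bsub>tensor_algebra B\<^esub> g \<in> {f \<in> free_on (lists B). nf f = 0}"
    by (auto simp: free_on_mult)
qed (rule ring_tensor_algebra)

lemma nf_sym_ideal: "f \<in> sym_ideal L \<Longrightarrow> nf f = 0"
proof -
  have "sym_ideal L \<subseteq> {f \<in> free_on (lists B). nf f = 0}"
    unfolding sym_ideal_def using kernel_nf_ideal sym_ideal_gens
    by (intro T.genideal_minimal) (auto simp: word2_S nf_diff nf_swap simp del: scale_bas)
  then show "f \<in> sym_ideal L \<Longrightarrow> nf f = 0" by auto
qed

lemma sym_ideal_add: "f \<in> sym_ideal L \<Longrightarrow> g \<in> sym_ideal L \<Longrightarrow> f + g \<in> sym_ideal L"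
  using I.a_closed by simp

lemma sym_ideal_mult:
  "f \<in> sym_ideal L \<Longrightarrow> g \<in> free_on (lists B) \<Longrightarrow> g * f \<in> sym_ideal L"
  "f \<in> sym_ideal L \<Longrightarrow> g \<in> free_on (lists B) \<Longrightarrow> f * g \<in> sym_ideal L"
  using I.I_l_closed I.I_r_closed by simp_all

lemma sym_ideal_scale: "f \<in> sym_ideal L \<Longrightarrow> scale c f \<in> sym_ideal L"
  using sym_ideal_mult(1)[of f "scale c 1"] by (simp add: scale_mult free_on_scale)

lemma sym_ideal_sum: "(\<And>a. a \<in> A \<Longrightarrow> h a \<in> sym_ideal L) \<Longrightarrow> sum h A \<in> sym_ideal L"
  using I.zero_closed by (induction A rule: infinite_finite_induct) (auto intro: sym_ideal_add)

text \<open>Straightening modulo the ideal: a generator times the rest of the word moves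
  \<open>x\<close> past a smaller first letter \<open>y\<close>; the induction hypothesis,
  multiplied by \<open>y\<close> from the left, moves it on.\<close>

lemma insort_sym_ideal:
  assumes "x \<in> B" "set w \<subseteq> B" "sorted w"
  shows "bas (x # w) - scale (crossl x w) (bas (insort x w)) \<in> sym_ideal L"
  using assms(2,3)
proof (induction w)
  case Nil
  then show ?case using I.zero_closed by simp
next
  case (Cons y w)
  show ?case
  proof (cases "x \<le> y")
    case True
    then have "crossl x (y # w) = 1" using Cons.prems by (intro crossl_le) auto
    then show ?thesis using True I.zero_closed by simp
  next
    case False
    have y: "y \<in> B" "set w \<subseteq> B" "sorted w" using Cons.prems by auto
    have "(bas [x, y] - word2 (tl_S L (bas (x, y)))) \<in> sym_ideal L"
      unfolding sym_ideal_def using sym_ideal_gens y assms(1) by (intro set_mp[OF T.genideal_self]) auto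
    then have "(bas [x, y] - word2 (tl_S L (bas (x, y)))) * bas w \<in> sym_ideal L"
      using y by (intro sym_ideal_mult(2)) auto
    then have 1: "bas (x # y # w) - scale (q x y) (bas (y # x # w)) \<in> sym_ideal L"
      using y assms(1) by (simp add: word2_S scale_mult bas_mult_bas left_diff_distrib del: scale_bas)
    have "bas [y] * (bas (x # w) - scale (crossl x w) (bas (insort x w))) \<in> sym_ideal L"
      using y Cons.IH by (intro sym_ideal_mult(1)) auto
    then have "bas (y # x # w) - scale (crossl x w) (bas (y # insort x w)) \<in> sym_ideal L"
      by (simp add: scale_mult bas_mult_bas right_diff_distrib del: scale_bas)
    then have "scale (q x y) (bas (y # x # w) - scale (crossl x w) (bas (y # insort x w))) \<in> sym_ideal L"
      by (rule sym_ideal_scale)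
    from sym_ideal_add[OF 1 this] False show ?thesis
      by (auto simp: free_mod.scale_right_diff_distrib cross_def not_le simp del: scale_bas)
  qed
qed

lemma sort_sym_ideal:
  assumes "set w \<subseteq> B"
  shows "bas w - scale (sort_coeff w) (bas (sort w)) \<in> sym_ideal L"
  using assms
proof (induction w)
  case Nil
  then show ?case using I.zero_closed by simp
next
  case (Cons x w)
  then have "bas [x] * (bas w - scale (sort_coeff w) (bas (sort w))) \<in> sym_ideal L"
    by (intro sym_ideal_mult(1)) auto
  then have 1: "bas (x # w) - scale (sort_coeff w) (bas (x # sort w)) \<in> sym_ideal L"
    by (simp add: scale_mult bas_mult_bas right_diff_distrib del: scale_bas)
  have "scale (sort_coeff w) (bas (x # sort w) - scale (crossl x (sort w)) (bas (insort x (sort w)))) \<in> sym_ideal L"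
    using Cons by (intro sym_ideal_scale insort_sym_ideal) auto
  from sym_ideal_add[OF 1 this] show ?case
    by (simp add: free_mod.scale_right_diff_distrib mult.commute del: scale_bas)
qed

lemma nf_diff_sym_ideal:
  assumes "f \<in> free_on (lists B)"
  shows "f - nf f \<in> sym_ideal L"
proof -
  have "f - nf f = lin_ext bas f - nf f" by simp
  also have "\<dots> = (\<Sum>w\<in>Poly_Mapping.keys f. scale (Poly_Mapping.lookup f w) (bas w - scale (sort_coeff w) (bas (sort w))))"
    unfolding nf_def lin_ext_def by (simp add: free_mod.scale_right_diff_distrib sum_subtractf del: scale_bas)
  also have "\<dots> \<in> sym_ideal L"
    using assms by (intro sym_ideal_sum sym_ideal_scale sort_sym_ideal) (auto dest: free_onD simp del: scale_bas)
  finally show ?thesis .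
qed

text \<open>One direction holds because \<open>nf\<close> vanishes on the ideal, the other because
  every element is congruent to its normal form. Together they give the basis of sorted
  words.\<close>

lemma sym_class_eq_iff:
  assumes "f \<in> free_on (lists B)" "g \<in> free_on (lists B)"
  shows "sym_class L f = sym_class L g \<longleftrightarrow> nf f = nf g"
proof -
  have "sym_class L f = sym_class L g \<longleftrightarrow> f - g \<in> sym_ideal L"
    unfolding sym_class_def using T.quotient_eq_iff_same_a_r_cos[OF I.is_ideal, of f g] assms
    by (simp add: tensor_algebra_minus)
  also have "\<dots> \<longleftrightarrow> nf f = nf g"
  proof
    assume "nf f = nf g"
    then have "f - g = (f - nf f) + scale (-1) (g - nf g)"
      by (simp add: free_mod.scale_right_diff_distrib)
    also have "\<dots> \<in> sym_ideal L" by (intro sym_ideal_add sym_ideal_scale nf_diff_sym_ideal assms)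
    finally show "f - g \<in> sym_ideal L" .
  qed (use nf_sym_ideal[of "f - g"] in \<open>auto simp: nf_diff\<close>)
  finally show ?thesis .
qed

section \<open>Computing in the quotient\<close>

sublocale Q: ring "sym_algebra L"
  unfolding sym_algebra_def by (rule I.quotient_is_ring)

lemma carrier_sym_algebra: "carrier (sym_algebra L) = sym_class L ` free_on (lists B)"
  by (auto simp: sym_algebra_def FactRing_def A_RCOSETS_def' sym_class_def)

lemma sym_class_carrier [simp]: "f \<in> free_on (lists B) \<Longrightarrow> sym_class L f \<in> carrier (sym_algebra L)"
  by (simp add: carrier_sym_algebra)

lemma sym_class_add:
  "f \<in> free_on (lists B) \<Longrightarrow> g \<in> free_on (lists B) \<Longrightarrow>
    sym_class L f \<oplus>\<^bsub>sym_algebra L\<^esub> sym_class L g = sym_class L (f + g)"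
  and sym_class_mult:
  "f \<in> free_on (lists B) \<Longrightarrow> g \<in> free_on (lists B) \<Longrightarrow>
    sym_class L f \<otimes>\<^bsub>sym_algebra L\<^esub> sym_class L g = sym_class L (f * g)"
  using ring_hom_add[OF I.rcos_ring_hom, of f g] ring_hom_mult[OF I.rcos_ring_hom, of f g]
  by (simp_all add: sym_algebra_def sym_class_def)

lemma sym_class_one: "\<one>\<^bsub>sym_algebra L\<^esub> = sym_class L 1"
  using ring_hom_one[OF I.rcos_ring_hom] by (simp add: sym_algebra_def sym_class_def)

lemma sym_class_zero: "\<zero>\<^bsub>sym_algebra L\<^esub> = sym_class L 0"
  using ring_hom_zero[OF I.rcos_ring_hom] by (simp add: sym_algebra_def sym_class_def Q.ring_axioms[unfolded sym_algebra_def] ring_tensor_algebra)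

lemma sym_class_diff:
  assumes "f \<in> free_on (lists B)" "g \<in> free_on (lists B)"
  shows "sym_class L f \<ominus>\<^bsub>sym_algebra L\<^esub> sym_class L g = sym_class L (f - g)"
proof -
  have "\<ominus>\<^bsub>sym_algebra L\<^esub> sym_class L g = sym_class L (- g)"
    using assms by (intro Q.minus_equality) (auto simp: sym_class_add sym_class_zero free_on_uminus)
  then show ?thesis using assms by (simp add: a_minus_def sym_class_add free_on_uminus)
qed

lemma sym_class_scale:
  "f \<in> free_on (lists B) \<Longrightarrow> sym_scale L c (sym_class L f) = sym_class L (scale c f)"
  unfolding sym_scale_def by (simp add: sym_class_mult free_on_scale one_free_on scale_mult)

lemma sym_mon_eq: "set w \<subseteq> B \<Longrightarrow> sym_mon L w = sym_class L (bas w)"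
proof (induction w)
  case (Cons x w)
  then have "sym_mon L (x # w) = sym_gen L x \<otimes>\<^bsub>sym_algebra L\<^esub> sym_class L (bas w)"
    by (simp add: sym_mon_def)
  then show ?case using Cons.prems by (simp add: sym_gen_def sym_class_mult bas_mult_bas lists_eq_set)
qed (simp add: sym_mon_def sym_class_one one_eq_bas)

lemma sym_class_sum:
  assumes "finite A" "\<And>a. a \<in> A \<Longrightarrow> h a \<in> free_on (lists B)"
  shows "finsum (sym_algebra L) (\<lambda>a. sym_class L (h a)) A = sym_class L (sum h A)"
  using assms
proof (induction A)
  case (insert a A)
  then have "(\<lambda>a. sym_class L (h a)) \<in> A \<rightarrow> carrier (sym_algebra L)" by auto
  with insert show ?case by (simp add: sym_class_add free_on_sum)
qed (simp add: sym_class_zero)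

text \<open>The representative is arbitrary, but \<open>nf\<close> is constant on classes; the
  result is the unique combination of sorted words in the class.\<close>

definition sym_rep :: "('b list \<Rightarrow>\<^sub>0 'k) set \<Rightarrow> ('b list \<Rightarrow>\<^sub>0 'k)" where
  "sym_rep z = nf (SOME f. f \<in> free_on (lists B) \<and> sym_class L f = z)"

lemma sym_rep_class:
  assumes "f \<in> free_on (lists B)"
  shows "sym_rep (sym_class L f) = nf f"
proof -
  have "(SOME g. g \<in> free_on (lists B) \<and> sym_class L g = sym_class L f) \<in> free_on (lists B) \<and>
    sym_class L (SOME g. g \<in> free_on (lists B) \<and> sym_class L g = sym_class L f) = sym_class L f"
    by (rule someI[of "\<lambda>g. g \<in> free_on (lists B) \<and> sym_class L g = sym_class L f" f]) (simp add: assms)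
  then show ?thesis unfolding sym_rep_def using assms sym_class_eq_iff by blast
qed

lemma sym_class_nf: "f \<in> free_on (lists B) \<Longrightarrow> sym_class L (nf f) = sym_class L f"
  by (subst sym_class_eq_iff) (auto intro: free_on_mono[OF nf_free_on])

lemma nf_sorted: "f \<in> free_on {w. set w \<subseteq> B \<and> sorted w} \<Longrightarrow> nf f = f"
  by (simp add: nf_def) (subst (2) lin_ext_id[symmetric], rule lin_ext_cong, auto dest!: free_onD simp: sort_coeff_sorted sorted_sort_id)

end

section \<open>The canonical map on normal forms\<close>

text \<open>Two facts make the recursion well founded: the angle bracket of a pair out of order has
  strictly smaller degree, and, generators having positive degree, dropping a letter lowers the
  degree of a word.\<close>

locale filtered_q_commutative = q_commutative +
  assumes br_zero: "tl_br L t = 0"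
    and T_bas: "x \<in> B \<Longrightarrow> y \<in> B \<Longrightarrow> tl_T L (bas (x, y)) = scale (q x y) (bas (y, x)) + tl_ang L (bas (x, y))"
    and ang_zero: "tl_ang L 0 = 0"
    and ang_closed: "x \<in> B \<Longrightarrow> y \<in> B \<Longrightarrow> tl_ang L (bas (x, y)) \<in> free_on (B \<times> B)"
    and ang_degree: "x \<in> B \<Longrightarrow> y \<in> B \<Longrightarrow> y < x \<Longrightarrow> (a, b) \<in> Poly_Mapping.keys (tl_ang L (bas (x, y))) \<Longrightarrow>
      tl_eta L a + tl_eta L b < tl_eta L x + tl_eta L y"
    and eta_pos: "x \<in> B \<Longrightarrow> tl_eta L x > 0"
begin

abbreviation "\<eta> \<equiv> tl_eta L"
abbreviation "\<eta>s \<equiv> tl_etas L"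

definition "sorted_words = {w. set w \<subseteq> B \<and> sorted w}"

text \<open>The bound is strict, so \<open>low (Suc d)\<close> means degree at most
  \<open>d\<close>: elements with and without their leading term are measured by the same
  notion.\<close>

definition low :: "nat \<Rightarrow> ('a list \<Rightarrow>\<^sub>0 'b) set" where
  "low s = free_on {w \<in> sorted_words. \<eta>s w < s}"

lemma low_mono: "f \<in> low s \<Longrightarrow> s \<le> s' \<Longrightarrow> f \<in> low s'"
  unfolding low_def by (erule free_on_mono) auto

lemma low_sorted: "f \<in> low s \<Longrightarrow> f \<in> free_on sorted_words"
  unfolding low_def by (erule free_on_mono) auto

lemma low_closed:
  "f \<in> low s \<Longrightarrow> g \<in> low s \<Longrightarrow> f + g \<in> low s"
  "f \<in> low s \<Longrightarrow> scale c f \<in> low s" "0 \<in> low s"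
  by (simp_all add: low_def free_on_add free_on_scale)

lemma etas_simps [simp]: "\<eta>s [] = 0" "\<eta>s (x # w) = \<eta> x + \<eta>s w"
  by (simp_all add: tl_etas_def)

lemma etas_sort [simp]: "\<eta>s (sort w) = \<eta>s w"
  unfolding tl_etas_def by (metis mset_map mset_sort sum_mset_sum_list)

lemma nf_low: "set w \<subseteq> B \<Longrightarrow> \<eta>s w < s \<Longrightarrow> nf (bas w) \<in> low s"
  by (simp add: nf_single low_def sorted_words_def)

lemma sorted_wordsD: "w \<in> sorted_words \<Longrightarrow> set w \<subseteq> B" "w \<in> sorted_words \<Longrightarrow> sorted w"
  by (auto simp: sorted_words_def)

definition op2 :: "('a \<Rightarrow> 'a list \<Rightarrow> ('a list \<Rightarrow>\<^sub>0 'b)) \<Rightarrow> ('a \<times> 'a \<Rightarrow>\<^sub>0 'b) \<Rightarrow> ('a list \<Rightarrow>\<^sub>0 'b) \<Rightarrow> ('a list \<Rightarrow>\<^sub>0 'b)" where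
  "op2 A t f = lin_ext (\<lambda>(a, b). lin_ext (A a) (lin_ext (A b) f)) t"

text \<open>The right-hand side of the recursion, for \<open>[,] = 0\<close>, as a functional of an
  arbitrary \<open>A\<close>. It is applied to a guarded function, to the solution, and to the
  function read off from a given action.\<close>

definition rhs :: "('a \<Rightarrow> 'a list \<Rightarrow> ('a list \<Rightarrow>\<^sub>0 'b)) \<Rightarrow> 'a \<Rightarrow> 'a \<Rightarrow> 'a list \<Rightarrow> ('a list \<Rightarrow>\<^sub>0 'b)" where
  "rhs A l m N = scale (q l m) (nf (bas (m # l # N)))
     + scale (q l m) (lin_ext (A m) (A l N - nf (bas (l # N))))
     + op2 A (tl_ang L (bas (l, m))) (bas N)"

text \<open>The bound \<open>D\<close> turns the statement into an induction hypothesis: the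
  recursion in total degree \<open>d\<close> uses it for degrees below \<open>d\<close>.\<close>

definition leading :: "('a \<Rightarrow> 'a list \<Rightarrow> ('a list \<Rightarrow>\<^sub>0 'b)) \<Rightarrow> nat \<Rightarrow> bool" where
  "leading A D \<longleftrightarrow> (\<forall>x\<in>B. \<forall>w\<in>sorted_words. \<eta> x + \<eta>s w < D \<longrightarrow> A x w - nf (bas (x # w)) \<in> low (\<eta> x + \<eta>s w))"

lemma leadingD:
  "leading A D \<Longrightarrow> x \<in> B \<Longrightarrow> w \<in> sorted_words \<Longrightarrow> \<eta> x + \<eta>s w < D \<Longrightarrow>
    A x w - nf (bas (x # w)) \<in> low (\<eta> x + \<eta>s w)"
  unfolding leading_def by blast

lemma leading_low:
  assumes "leading A D" "x \<in> B" "w \<in> sorted_words" "\<eta> x + \<eta>s w < D"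
  shows "A x w \<in> low (Suc (\<eta> x + \<eta>s w))"
proof -
  have 1: "A x w - nf (bas (x # w)) \<in> low (Suc (\<eta> x + \<eta>s w))"
    by (rule low_mono[OF leadingD[OF assms]]) simp
  have 2: "nf (bas (x # w)) \<in> low (Suc (\<eta> x + \<eta>s w))"
    using assms(2) sorted_wordsD(1)[OF assms(3)] by (intro nf_low) auto
  show ?thesis using low_closed(1)[OF 1 2] by simp
qed

lemma leading_lin_ext_low:
  assumes "leading A D" "x \<in> B" "f \<in> low s" "\<eta> x + s \<le> D"
  shows "lin_ext (A x) f \<in> low (\<eta> x + s)"
  unfolding low_def
proof (rule lin_ext_free_on[OF assms(3)[unfolded low_def]])
  fix w assume w: "w \<in> {w \<in> sorted_words. \<eta>s w < s}"
  then have "w \<in> sorted_words" "\<eta> x + \<eta>s w < D" "Suc (\<eta> x + \<eta>s w) \<le> \<eta> x + s"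
    using assms(4) by auto
  then have "A x w \<in> low (\<eta> x + s)"
    by (intro low_mono[OF leading_low[OF assms(1,2), of w]])
  then show "A x w \<in> free_on {w \<in> sorted_words. \<eta>s w < \<eta> x + s}" unfolding low_def .
qed

lemma nf_head_swap:
  "m < l \<Longrightarrow> nf (bas (l # m # N)) = scale (q l m) (nf (bas (m # l # N)))"
proof -
  assume ml: "m < l"
  have "sort (l # m # N) = sort (m # l # N)" by (rule properties_for_sort) (auto simp: sorted_insort)
  moreover have "sort_coeff (l # m # N) = q l m * sort_coeff (m # l # N)"
    using ml less_not_sym[OF ml] by (simp add: cross_def mult_ac)
  ultimately show ?thesis
    by (simp only: nf_single scale_single mult_1_left)
qed

lemma tail_sorted_words: "m # N \<in> sorted_words \<Longrightarrow> m \<in> B \<and> N \<in> sorted_words"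
  by (auto simp: sorted_words_def)

text \<open>The first summand of \<open>rhs\<close> is the normal form of the whole word, by
  \<open>nf_head_swap\<close>. The second is of lower degree because the leading term of
  \<open>A l N\<close> is subtracted before \<open>m\<close> acts, the third because of the angle
  bracket.\<close>

lemma leading_rhs:
  assumes A: "leading A (\<eta> l + \<eta> m + \<eta>s N)" and l: "l \<in> B" "m # N \<in> sorted_words" "m < l"
  shows "rhs A l m N - nf (bas (l # m # N)) \<in> low (\<eta> l + \<eta> m + \<eta>s N)"
proof -
  have N: "m \<in> B" "N \<in> sorted_words" using l tail_sorted_words by auto
  have "A l N - nf (bas (l # N)) \<in> low (\<eta> l + \<eta>s N)"
    using N l eta_pos[of m] by (intro leadingD[OF A]) auto
  then have 1: "lin_ext (A m) (A l N - nf (bas (l # N))) \<in> low (\<eta> m + (\<eta> l + \<eta>s N))"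
    using A N by (intro leading_lin_ext_low) auto
  have "lin_ext (A a) (A b N) \<in> low (\<eta> l + \<eta> m + \<eta>s N)"
    if "(a, b) \<in> Poly_Mapping.keys (tl_ang L (bas (l, m)))" for a b
  proof -
    have ab: "a \<in> B" "b \<in> B" "\<eta> a + \<eta> b < \<eta> l + \<eta> m"
      using that free_onD[OF ang_closed[of l m] that] ang_degree l N by auto
    \<comment> \<open>\<open>Suc\<close> appears because \<open>A b N\<close> keeps its leading
      term; the strict drop from \<open>l\<close>, \<open>m\<close> to \<open>a\<close>,
      \<open>b\<close> compensates for it.\<close>
    then have "lin_ext (A a) (A b N) \<in> low (\<eta> a + Suc (\<eta> b + \<eta>s N))"
      using A N by (intro leading_lin_ext_low[OF A] leading_low[OF A]) auto
    then show ?thesis using ab by (elim low_mono) auto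
  qed
  then have 2: "op2 A (tl_ang L (bas (l, m))) (bas N) \<in> low (\<eta> l + \<eta> m + \<eta>s N)"
    unfolding op2_def low_def
    by (intro lin_ext_free_on[of _ "Poly_Mapping.keys (tl_ang L (bas (l, m)))"]) (auto simp: free_on_def)
  have "rhs A l m N - nf (bas (l # m # N)) =
      scale (q l m) (lin_ext (A m) (A l N - nf (bas (l # N)))) + op2 A (tl_ang L (bas (l, m))) (bas N)"
    unfolding nf_head_swap[OF l(3)] rhs_def by simp
  also have "\<dots> \<in> low (\<eta> l + \<eta> m + \<eta>s N)"
    using 1 2 by (intro low_closed) (simp_all add: add_ac)
  finally show ?thesis .
qed

text \<open>\<open>rhs\<close> evaluates \<open>A\<close> solely on words of degree below that of
  \<open>l\<close>, \<open>m\<close>, \<open>N\<close> together. This allows a guard on the degree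
  to be removed afterwards.\<close>

lemma rhs_cong:
  assumes A: "leading A (\<eta> l + \<eta> m + \<eta>s N)" and l: "l \<in> B" "m # N \<in> sorted_words" "m < l"
    and eq: "\<And>x w. x \<in> B \<Longrightarrow> w \<in> sorted_words \<Longrightarrow> \<eta> x + \<eta>s w < \<eta> l + \<eta> m + \<eta>s N \<Longrightarrow> A x w = A' x w"
  shows "rhs A l m N = rhs A' l m N"
proof -
  have N: "m \<in> B" "N \<in> sorted_words" using l tail_sorted_words by auto
  have lin: "lin_ext (A x) f = lin_ext (A' x) f" if "x \<in> B" "f \<in> low s" "\<eta> x + s \<le> \<eta> l + \<eta> m + \<eta>s N" for x s f
    using that eq by (intro lin_ext_cong) (auto simp: low_def dest!: free_onD)
  have lN: "A l N = A' l N" using N l eta_pos[of m] by (intro eq) auto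
  have "A l N - nf (bas (l # N)) \<in> low (\<eta> l + \<eta>s N)"
    using N l eta_pos[of m] by (intro leadingD[OF A]) auto
  then have 1: "lin_ext (A m) (A l N - nf (bas (l # N))) = lin_ext (A' m) (A l N - nf (bas (l # N)))"
    using N by (intro lin) auto
  have "lin_ext (A a) (A b N) = lin_ext (A' a) (A' b N)"
    if "(a, b) \<in> Poly_Mapping.keys (tl_ang L (bas (l, m)))" for a b
  proof -
    have ab: "a \<in> B" "b \<in> B" "\<eta> a + \<eta> b < \<eta> l + \<eta> m"
      using that free_onD[OF ang_closed[of l m] that] ang_degree l N by auto
    then have 1: "lin_ext (A a) (A b N) = lin_ext (A' a) (A b N)"
      using N by (intro lin[of _ _ "Suc (\<eta> b + \<eta>s N)"] leading_low[OF A]) auto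
    have 2: "A b N = A' b N" using ab N by (intro eq) auto
    show ?thesis using 1 2 by simp
  qed
  then have "op2 A (tl_ang L (bas (l, m))) (bas N) = op2 A' (tl_ang L (bas (l, m))) (bas N)"
    unfolding op2_def by (intro lin_ext_cong) auto
  with 1 lN show ?thesis unfolding rhs_def by simp
qed

section \<open>Solutions of the recursion on sorted words\<close>

definition canonical :: "('a \<Rightarrow> 'a list \<Rightarrow> ('a list \<Rightarrow>\<^sub>0 'b)) \<Rightarrow> bool" where
  "canonical A \<longleftrightarrow>
    (\<forall>l\<in>B. \<forall>w\<in>sorted_words. le_seq l w \<longrightarrow> A l w = bas (l # w)) \<and>
    (\<forall>l\<in>B. \<forall>m N. m # N \<in> sorted_words \<and> m < l \<longrightarrow> A l (m # N) = rhs A l m N)"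

lemma le_seq_cases:
  assumes "w \<in> sorted_words"
  obtains "le_seq l w" | m N where "w = m # N" "m < l"
  using assms by (cases w; cases "l \<le> hd w") (auto simp: le_seq_def not_le)

lemma le_seq_sorted_words: "l \<in> B \<Longrightarrow> w \<in> sorted_words \<Longrightarrow> le_seq l w \<Longrightarrow> l # w \<in> sorted_words"
  by (cases w) (auto simp: sorted_words_def le_seq_def)

lemma nf_sorted_word: "w \<in> sorted_words \<Longrightarrow> nf (Poly_Mapping.single w c) = Poly_Mapping.single w c"
  by (simp add: sorted_words_def nf_single sort_coeff_sorted sorted_sort_id)

lemma canonical_leading:
  assumes "canonical A"
  shows "leading A D"
proof (induction D rule: less_induct)
  case (less D)
  show ?case unfolding leading_def
  proof (intro ballI impI)
    fix l w assume lw: "l \<in> B" "w \<in> sorted_words" "\<eta> l + \<eta>s w < D"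
    show "A l w - nf (bas (l # w)) \<in> low (\<eta> l + \<eta>s w)"
      using lw(2)
    proof (cases rule: le_seq_cases[of w l])
      case 1
      then show ?thesis using assms lw le_seq_sorted_words[of l w]
        by (auto simp: canonical_def nf_sorted_word low_closed)
    next
      case (2 m N)
      then show ?thesis using assms lw leading_rhs[OF less.IH, of l m N]
        by (auto simp: canonical_def add_ac)
    qed
  qed
qed

text \<open>
  The guard makes termination evident.  By \<open>leading_rhs\<close>, the calls that it cuts off never occur for
  sorted words.
\<close>

function recur :: "'a \<Rightarrow> 'a list \<Rightarrow> ('a list \<Rightarrow>\<^sub>0 'b)" where
  "recur l [] = bas [l]"
| "recur l (m # N) = (if m < l then rhs (\<lambda>x w. if \<eta> x + \<eta>s w < \<eta> l + \<eta> m + \<eta>s N then recur x w else 0) l m N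
     else bas (l # m # N))"
  by pat_completeness auto
termination
  by (relation "measure (\<lambda>(l, w). \<eta> l + \<eta>s w)") auto

lemma leading_recur: "leading recur D"
proof (induction D rule: less_induct)
  case (less D)
  show ?case unfolding leading_def
  proof (intro ballI impI)
    fix l w assume lw: "l \<in> B" "w \<in> sorted_words" "\<eta> l + \<eta>s w < D"
    show "recur l w - nf (bas (l # w)) \<in> low (\<eta> l + \<eta>s w)"
    proof (cases w)
      case Nil
      then show ?thesis using nf_sorted_word[of "[l]" 1] lw by (simp add: sorted_words_def low_closed)
    next
      case (Cons m N)
      \<comment> \<open>The guarded function agrees with \<open>recur\<close> below this degree and
        so inherits the induction hypothesis.\<close>
      have "leading (\<lambda>x w. if \<eta> x + \<eta>s w < \<eta> l + \<eta> m + \<eta>s N then recur x w else 0) (\<eta> l + \<eta> m + \<eta>s N)"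
        using less.IH[of "\<eta> l + \<eta> m + \<eta>s N"] lw Cons by (auto simp: leading_def)
      note rhs = leading_rhs[OF this lw(1)]
      show ?thesis
      proof (cases "m < l")
        case True
        then have "recur l w = rhs (\<lambda>x w. if \<eta> x + \<eta>s w < \<eta> l + \<eta> m + \<eta>s N then recur x w else 0) l m N"
          unfolding Cons by (subst recur.simps) simp
        with rhs[OF _ True] lw Cons show ?thesis by (simp add: add.assoc)
      next
        case False
        then have "l # w \<in> sorted_words" using lw Cons by (intro le_seq_sorted_words) (auto simp: le_seq_def)
        then show ?thesis using False Cons by (simp add: nf_sorted_word low_closed)
      qed
    qed
  qed
qed

lemma canonical_recur: "canonical recur"
  unfolding canonical_def
proof (intro conjI ballI allI impI)
  fix l w assume "l \<in> B" "w \<in> sorted_words" "le_seq l w"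
  then show "recur l w = bas (l # w)" by (cases w) (auto simp: le_seq_def)
next
  fix l m N assume l: "l \<in> B" "m # N \<in> sorted_words \<and> m < l"
  have "rhs recur l m N = rhs (\<lambda>x w. if \<eta> x + \<eta>s w < \<eta> l + \<eta> m + \<eta>s N then recur x w else 0) l m N"
    using l by (intro rhs_cong leading_recur) auto
  also have "\<dots> = recur l (m # N)" using l by (subst recur.simps) simp
  finally show "recur l (m # N) = rhs recur l m N" ..
qed

lemma canonical_closed:
  "canonical A \<Longrightarrow> x \<in> B \<Longrightarrow> w \<in> sorted_words \<Longrightarrow> A x w \<in> free_on sorted_words"
  using leading_low[OF canonical_leading[of A "Suc (\<eta> x + \<eta>s w)"], of x w] by (simp add: low_sorted)

text \<open>The dictionary between an action on classes and a function on sorted words. The value at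
  0 is listed separately because the bracket term of the recursion is \<open>act 0\<close>, while
  additivity in the first argument is not part of the notion.\<close>

definition represents where
  "represents A act \<longleftrightarrow>
    (\<forall>x\<in>B. \<forall>w\<in>sorted_words. A x w \<in> free_on sorted_words) \<and>
    (\<forall>x\<in>B. \<forall>f\<in>free_on sorted_words. act (bas x) (sym_class L f) = sym_class L (lin_ext (A x) f)) \<and>
    (\<forall>z\<in>carrier (sym_algebra L). act 0 z = sym_class L 0)"

lemma sorted_free_on: "f \<in> free_on sorted_words \<Longrightarrow> f \<in> free_on (lists B)"
  by (erule free_on_mono) (auto simp: sorted_words_def)

lemma nf_free_on_sorted: "f \<in> free_on sorted_words \<Longrightarrow> nf f = f"
  unfolding sorted_words_def by (rule nf_sorted)

lemma nf_word_sorted: "set w \<subseteq> B \<Longrightarrow> nf (bas w) \<in> free_on sorted_words"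
  unfolding sorted_words_def by (intro nf_free_on) auto

lemma represents_act:
  assumes "represents A act" "x \<in> B" "f \<in> free_on sorted_words"
  shows "act (bas x) (sym_class L f) = sym_class L (lin_ext (A x) f)" "lin_ext (A x) f \<in> free_on sorted_words"
  using assms by (auto simp: represents_def intro: lin_ext_free_on[of _ sorted_words])

lemma represents_act2:
  assumes A: "represents A act" and t: "t \<in> free_on (B \<times> B)" and f: "f \<in> free_on sorted_words"
  shows "act2 L act t (sym_class L f) = sym_class L (op2 A t f)" "op2 A t f \<in> free_on sorted_words"
proof -
  have ab: "a \<in> B" "b \<in> B" if "(a, b) \<in> Poly_Mapping.keys t" for a b
    using t that by (auto dest: free_onD)
  have cl: "lin_ext (A a) (lin_ext (A b) f) \<in> free_on sorted_words" if "(a, b) \<in> Poly_Mapping.keys t" for a b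
    using ab[OF that] by (intro represents_act(2)[OF A] f)
  define h where "h = (\<lambda>(a, b). scale (Poly_Mapping.lookup t (a, b)) (lin_ext (A a) (lin_ext (A b) f)))"
  have h: "h x \<in> free_on sorted_words" if "x \<in> Poly_Mapping.keys t" for x
    using that cl by (cases x) (auto simp: h_def free_on_scale)
  have op: "op2 A t f = sum h (Poly_Mapping.keys t)"
    by (simp add: op2_def lin_ext_def h_def case_prod_unfold)
  show "op2 A t f \<in> free_on sorted_words" unfolding op by (intro free_on_sum h)
  have "act2 L act t (sym_class L f) = finsum (sym_algebra L) (\<lambda>x. sym_class L (h x)) (Poly_Mapping.keys t)"
    unfolding act2_def
  proof (intro Q.finsum_cong' funcsetI)
    fix x assume x: "x \<in> Poly_Mapping.keys t"
    obtain a b where xab: "x = (a, b)" by (cases x)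
    show "(case x of (a, b) \<Rightarrow> sym_scale L (Poly_Mapping.lookup t (a, b)) (act (bas a) (act (bas b) (sym_class L f)))) = sym_class L (h x)"
      using x ab[of a b] f cl[of a b] unfolding xab
      by (simp add: h_def represents_act[OF A] sym_class_scale sorted_free_on)
  qed (auto simp: h sorted_free_on)
  also have "\<dots> = sym_class L (sum h (Poly_Mapping.keys t))"
    by (intro sym_class_sum sorted_free_on h) auto
  finally show "act2 L act t (sym_class L f) = sym_class L (op2 A t f)" by (simp add: op)
qed

lemma sym_mon_sorted: "w \<in> sorted_words \<Longrightarrow> sym_mon L w = sym_class L (bas w)"
  by (simp add: sym_mon_eq sorted_words_def)

lemma sym_gen_mult: "x \<in> B \<Longrightarrow> f \<in> free_on (lists B) \<Longrightarrow> 
    sym_gen L x \<otimes>\<^bsub>sym_algebra L\<^esub> sym_class L f = sym_class L (bas [x] * f)"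
  by (simp add: sym_gen_def sym_class_mult)

text \<open>A term by term translation of the recursion, used in both directions: to verify it for a
  constructed action and to extract it from a given one.\<close>

lemma represents_rhs:
  assumes A: "represents A act" and l: "l \<in> B" "m # N \<in> sorted_words" "m < l"
  shows "sym_scale L (q l m) (sym_gen L m \<otimes>\<^bsub>sym_algebra L\<^esub> (sym_gen L l \<otimes>\<^bsub>sym_algebra L\<^esub> sym_mon L N))
           \<oplus>\<^bsub>sym_algebra L\<^esub> sym_scale L (q l m) (act (bas m)
                 (act (bas l) (sym_mon L N) \<ominus>\<^bsub>sym_algebra L\<^esub> sym_gen L l \<otimes>\<^bsub>sym_algebra L\<^esub> sym_mon L N))
           \<oplus>\<^bsub>sym_algebra L\<^esub> act2 L act (tl_ang L (bas (l, m))) (sym_mon L N)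
           \<oplus>\<^bsub>sym_algebra L\<^esub> act (tl_br L (bas (l, m))) (sym_mon L N)
    = sym_class L (rhs A l m N)" "rhs A l m N \<in> free_on sorted_words"
proof -
  have N: "m \<in> B" "N \<in> sorted_words" using l tail_sorted_words by auto
  note N' = sorted_wordsD[OF N(2)]
  have bN: "bas N \<in> free_on sorted_words" using N by simp
  have AN: "A l N \<in> free_on sorted_words" using A l N by (auto simp: represents_def)
  have nl: "nf (bas (l # N)) \<in> free_on sorted_words" "nf (bas (m # l # N)) \<in> free_on sorted_words"
    using l N N' by (auto intro!: nf_word_sorted)
  have D: "A l N - nf (bas (l # N)) \<in> free_on sorted_words" using AN nl by (intro free_on_diff)
  note R2 = represents_act2[OF A ang_closed[OF l(1) N(1)] bN]
  note R1 = represents_act[OF A N(1) D]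
  show "rhs A l m N \<in> free_on sorted_words"
    unfolding rhs_def using R1 R2 nl by (intro free_on_add free_on_scale) auto
  have e1: "sym_gen L m \<otimes>\<^bsub>sym_algebra L\<^esub> (sym_gen L l \<otimes>\<^bsub>sym_algebra L\<^esub> sym_mon L N) = sym_class L (nf (bas (m # l # N)))"
    using l N N' by (simp add: sym_mon_sorted sym_gen_mult bas_mult_bas sym_class_nf)
  have e2: "act (bas l) (sym_mon L N) \<ominus>\<^bsub>sym_algebra L\<^esub> sym_gen L l \<otimes>\<^bsub>sym_algebra L\<^esub> sym_mon L N
     = sym_class L (A l N - nf (bas (l # N)))"
  proof -
    have "sym_gen L l \<otimes>\<^bsub>sym_algebra L\<^esub> sym_mon L N = sym_class L (nf (bas (l # N)))"
      using l N N' by (simp add: sym_mon_sorted sym_gen_mult bas_mult_bas sym_class_nf)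
    then show ?thesis using represents_act[OF A l(1) bN] N AN nl
      by (simp add: sym_mon_sorted sym_class_diff sorted_free_on)
  qed
  have e3: "act (tl_br L (bas (l, m))) (sym_mon L N) = sym_class L 0"
    using A N N' by (auto simp: represents_def br_zero sym_mon_sorted)
  show "sym_scale L (q l m) (sym_gen L m \<otimes>\<^bsub>sym_algebra L\<^esub> (sym_gen L l \<otimes>\<^bsub>sym_algebra L\<^esub> sym_mon L N))
           \<oplus>\<^bsub>sym_algebra L\<^esub> sym_scale L (q l m) (act (bas m)
                 (act (bas l) (sym_mon L N) \<ominus>\<^bsub>sym_algebra L\<^esub> sym_gen L l \<otimes>\<^bsub>sym_algebra L\<^esub> sym_mon L N))
           \<oplus>\<^bsub>sym_algebra L\<^esub> act2 L act (tl_ang L (bas (l, m))) (sym_mon L N)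
           \<oplus>\<^bsub>sym_algebra L\<^esub> act (tl_br L (bas (l, m))) (sym_mon L N)
    = sym_class L (rhs A l m N)"
    unfolding e1 e2 e3
    unfolding R1 sym_mon_sorted[OF N(2)] R2 rhs_def
    using nl R1 R2 by (simp add: sym_class_scale sym_class_add sorted_free_on free_on_scale free_on_add)
qed

end

section \<open>Canonical maps and solutions on sorted words\<close>

context filtered_q_commutative
begin

lemma ordered_seq_iff: "ordered_seq L w \<longleftrightarrow> w \<in> sorted_words"
  by (auto simp: ordered_seq_def sorted_words_def q_self subset_iff)

lemma sorted_class_cases:
  assumes "z \<in> carrier (sym_algebra L)"
  obtains f where "f \<in> free_on sorted_words" "z = sym_class L f"
proof -
  obtain g where g: "g \<in> free_on (lists B)" "z = sym_class L g"
    using assms by (auto simp: carrier_sym_algebra)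
  then have "nf g \<in> free_on sorted_words" "z = sym_class L (nf g)"
    using nf_free_on[of g] by (auto simp: sorted_words_def sym_class_nf)
  then show ?thesis by (rule that)
qed

lemma sym_rep_sorted: "f \<in> free_on sorted_words \<Longrightarrow> sym_rep (sym_class L f) = f"
  by (simp add: sym_rep_class sorted_free_on nf_free_on_sorted)

lemma canonical_map_exists: "\<exists>act. canonical_map L act"
proof -
  \<comment> \<open>The bilinear extension of \<open>recur\<close>; \<open>sym_rep\<close> makes it
    well defined on classes.\<close>
  define act where "act = (\<lambda>a z. sym_class L (lin_ext (\<lambda>x. lin_ext (recur x) (sym_rep z)) a))"
  have closed: "lin_ext (\<lambda>x. lin_ext (recur x) f) a \<in> free_on sorted_words"
    if "a \<in> free_on B" "f \<in> free_on sorted_words" for a f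
    using that canonical_closed[OF canonical_recur] by (blast intro: lin_ext_free_on)
  have act: "act a (sym_class L f) = sym_class L (lin_ext (\<lambda>x. lin_ext (recur x) f) a)"
    if "f \<in> free_on sorted_words" for a f
    using that by (simp add: act_def sym_rep_sorted)
  have rep: "represents recur act"
    unfolding represents_def
    using canonical_closed[OF canonical_recur] by (auto simp: act elim: sorted_class_cases)
  have gen: "act (bas l) (sym_mon L w) = sym_gen L l \<otimes>\<^bsub>sym_algebra L\<^esub> sym_mon L w"
    if "l \<in> B" "w \<in> sorted_words" "le_seq l w" for l w
    using that canonical_recur sorted_wordsD(1)[of w]
    by (simp add: act sym_mon_sorted sym_gen_mult bas_mult_bas canonical_def)
  show ?thesis
    unfolding canonical_map_def Let_def ordered_seq_iff
  proof (intro exI[of _ act] conjI ballI allI impI)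
    fix a b :: "'a \<Rightarrow>\<^sub>0 'b" and z y c assume a: "a \<in> free_on B" and z: "z \<in> carrier (sym_algebra L)"
    from z obtain f where f: "f \<in> free_on sorted_words" "z = sym_class L f" by (rule sorted_class_cases)
    show "act a z \<in> carrier (sym_algebra L)"
      using f closed[OF a f(1)] by (simp add: act sorted_free_on)
    show "act (scale c a) z = sym_scale L c (act a z)" "act a (sym_scale L c z) = sym_scale L c (act a z)"
      using f closed[OF a f(1)] by (simp_all add: act sym_class_scale sorted_free_on lin_ext_scale free_on_scale scale_lin_ext mult.commute)
    { assume b: "b \<in> free_on B"
      show "act (a + b) z = act a z \<oplus>\<^bsub>sym_algebra L\<^esub> act b z"
        using f closed[OF a f(1)] closed[OF b f(1)] by (simp add: act sym_class_add sorted_free_on lin_ext_add) }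
    { assume "y \<in> carrier (sym_algebra L)"
      then obtain g where g: "g \<in> free_on sorted_words" "y = sym_class L g" by (rule sorted_class_cases)
      have "lin_ext (\<lambda>x. lin_ext (recur x) (g + f)) a = lin_ext (\<lambda>x. lin_ext (recur x) g) a + lin_ext (\<lambda>x. lin_ext (recur x) f) a"
        by (simp add: lin_ext_add lin_ext_fun_add)
      then show "act a (y \<oplus>\<^bsub>sym_algebra L\<^esub> z) = act a y \<oplus>\<^bsub>sym_algebra L\<^esub> act a z"
        using f g closed[OF a f(1)] closed[OF a g(1)]
        by (simp add: act sym_class_add sorted_free_on free_on_add) }
  next
    fix l w assume "l \<in> B" "w \<in> sorted_words \<and> le_seq l w"
    then show "act (bas l) (sym_mon L w) = sym_gen L l \<otimes>\<^bsub>sym_algebra L\<^esub> sym_mon L w"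
      using gen by auto
  next
    fix l m N assume l: "l \<in> B" "m # N \<in> sorted_words \<and> m < l"
    then have "act (bas l) (sym_mon L (m # N)) = sym_class L (rhs recur l m N)"
      using canonical_recur by (simp add: sym_mon_sorted act canonical_def del: recur.simps)
    then show "act (bas l) (sym_mon L (m # N)) =
         sym_scale L (q l m) (sym_gen L m \<otimes>\<^bsub>sym_algebra L\<^esub> (sym_gen L l \<otimes>\<^bsub>sym_algebra L\<^esub> sym_mon L N))
           \<oplus>\<^bsub>sym_algebra L\<^esub> sym_scale L (q l m) (act (bas m)
                 (act (bas l) (sym_mon L N) \<ominus>\<^bsub>sym_algebra L\<^esub> sym_gen L l \<otimes>\<^bsub>sym_algebra L\<^esub> sym_mon L N))
           \<oplus>\<^bsub>sym_algebra L\<^esub> act2 L act (tl_ang L (bas (l, m))) (sym_mon L N)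
           \<oplus>\<^bsub>sym_algebra L\<^esub> act (tl_br L (bas (l, m))) (sym_mon L N)"
      using represents_rhs(1)[OF rep] l by simp
  qed
qed

definition act_words where
  "act_words act x w = sym_rep (act (bas x) (sym_class L (bas w)))"

text \<open>By linearity, the action of a generator is determined by its values on the classes of
  sorted words.\<close>

lemma canonical_map_represents:
  assumes "canonical_map L act"
  shows "represents (act_words act) act"
proof -
  note C = assms[unfolded canonical_map_def Let_def]
  have closed: "act a z \<in> carrier (sym_algebra L)" if "a \<in> free_on B" "z \<in> carrier (sym_algebra L)" for a z
    using conjunct1[OF C] that by simp
  have add: "act a (y \<oplus>\<^bsub>sym_algebra L\<^esub> z) = act a y \<oplus>\<^bsub>sym_algebra L\<^esub> act a z"
    if "a \<in> free_on B" "y \<in> carrier (sym_algebra L)" "z \<in> carrier (sym_algebra L)" for a y z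
    using conjunct1[OF conjunct2[OF conjunct2[OF C]]] that by simp
  have sc: "act (scale c a) z = sym_scale L c (act a z)" "act a (sym_scale L c z) = sym_scale L c (act a z)"
    if "a \<in> free_on B" "z \<in> carrier (sym_algebra L)" for c a z
    using conjunct1[OF conjunct2[OF conjunct2[OF conjunct2[OF C]]]] that by simp_all
  \<comment> \<open>Together with homogeneity this gives the value of the action when either
    argument is 0.\<close>
  have zero: "sym_scale L 0 z = sym_class L 0" if "z \<in> carrier (sym_algebra L)" for z
    using that by (auto elim!: sorted_class_cases simp: sym_class_scale sorted_free_on)
  have A: "act_words act x w \<in> free_on sorted_words" "sym_class L (act_words act x w) = act (bas x) (sym_class L (bas w))"
    if xw: "x \<in> B" "w \<in> sorted_words" for x w
  proof -
    have "act (bas x) (sym_class L (bas w)) \<in> carrier (sym_algebra L)"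
      using xw sorted_wordsD[OF xw(2)] by (intro closed) auto
    then obtain f where "f \<in> free_on sorted_words" "act (bas x) (sym_class L (bas w)) = sym_class L f"
      by (rule sorted_class_cases)
    then show "act_words act x w \<in> free_on sorted_words" "sym_class L (act_words act x w) = act (bas x) (sym_class L (bas w))"
      by (simp_all add: act_words_def sym_rep_sorted)
  qed
  \<comment> \<open>Additivity is known for two summands in the quotient ring; induction over a
    finite support extends it to all combinations of sorted words.\<close>
  have sum: "act (bas x) (sym_class L (\<Sum>w\<in>K. scale (c w) (bas w))) = sym_class L (\<Sum>w\<in>K. scale (c w) (act_words act x w))
    \<and> (\<Sum>w\<in>K. scale (c w) (act_words act x w)) \<in> free_on sorted_words"
    if "x \<in> B" "finite K" "K \<subseteq> sorted_words" for x c K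
    using that(2,3)
  proof (induction K)
    case empty
    then show ?case using sc(2)[of "bas x" "sym_class L 0" 0] zero[of "sym_class L 0"] zero[OF closed, of "bas x" "sym_class L 0"] that(1) by simp
  next
    case (insert w K)
    let ?s = "\<Sum>w\<in>K. scale (c w) (bas w)"
    have w: "w \<in> sorted_words" "set w \<subseteq> B" using insert.prems sorted_wordsD by auto
    have s: "?s \<in> free_on (lists B)"
      using insert.prems sorted_wordsD(1) by (intro free_on_sum free_on_scale free_on_word) blast
    have "sym_class L (\<Sum>w\<in>insert w K. scale (c w) (bas w)) = sym_scale L (c w) (sym_class L (bas w)) \<oplus>\<^bsub>sym_algebra L\<^esub> sym_class L ?s"
      using insert.hyps w s by (simp add: sym_class_scale sym_class_add)
    moreover have "act (bas x) \<dots> = sym_scale L (c w) (sym_class L (act_words act x w)) \<oplus>\<^bsub>sym_algebra L\<^esub> sym_class L (\<Sum>w\<in>K. scale (c w) (act_words act x w))"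
    proof -
      have "sym_scale L (c w) (sym_class L (bas w)) \<in> carrier (sym_algebra L)"
        using w by (simp add: sym_class_scale)
      then show ?thesis
        using that(1) w s insert.IH insert.prems A(2)[OF that(1) w(1)]
          add[of "bas x" "sym_scale L (c w) (sym_class L (bas w))" "sym_class L ?s"]
          sc(2)[of "bas x" "sym_class L (bas w)" "c w"]
        by (simp del: scale_bas)
    qed
    ultimately show ?case using insert A(1)[OF that(1) w(1)]
      by (simp add: sym_class_scale sym_class_add sorted_free_on free_on_scale free_on_add)
  qed
  show ?thesis unfolding represents_def
  proof (intro conjI ballI)
    fix x and f :: "'a list \<Rightarrow>\<^sub>0 'b" assume x: "x \<in> B" and f: "f \<in> free_on sorted_words"
    have "sym_class L f = sym_class L (lin_ext bas f)" by simp
    then show "act (bas x) (sym_class L f) = sym_class L (lin_ext (act_words act x) f)"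
      using sum[OF x, of "Poly_Mapping.keys f" "Poly_Mapping.lookup f"] f unfolding lin_ext_def by (auto simp: free_on_def)
  next
    fix z assume "z \<in> carrier (sym_algebra L)"
    then show "act 0 z = sym_class L 0" using sc(1)[of 0 z 0] zero[OF closed[of 0 z]] by simp
  qed (use A in auto)
qed

lemma canonical_map_canonical:
  assumes "canonical_map L act"
  shows "canonical (act_words act)"
proof -
  note C = assms[unfolded canonical_map_def Let_def ordered_seq_iff]
  note rep = canonical_map_represents[OF assms]
  show ?thesis unfolding canonical_def
  proof (intro conjI ballI allI impI)
    fix l w assume l: "l \<in> B" "w \<in> sorted_words" "le_seq l w"
    then have "act (bas l) (sym_mon L w) = sym_gen L l \<otimes>\<^bsub>sym_algebra L\<^esub> sym_mon L w"
      using conjunct1[OF conjunct2[OF conjunct2[OF conjunct2[OF conjunct2[OF C]]]]] by simp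
    with l show "act_words act l w = bas (l # w)" using sorted_wordsD(1)[of w] le_seq_sorted_words[of l w]
      by (simp add: act_words_def sym_mon_sorted sym_gen_mult bas_mult_bas sym_rep_sorted)
  next
    fix l m N assume l: "l \<in> B" "m # N \<in> sorted_words \<and> m < l"
    have "act (bas l) (sym_mon L (m # N)) =
         sym_scale L (q l m) (sym_gen L m \<otimes>\<^bsub>sym_algebra L\<^esub> (sym_gen L l \<otimes>\<^bsub>sym_algebra L\<^esub> sym_mon L N))
           \<oplus>\<^bsub>sym_algebra L\<^esub> sym_scale L (q l m) (act (bas m)
                 (act (bas l) (sym_mon L N) \<ominus>\<^bsub>sym_algebra L\<^esub> sym_gen L l \<otimes>\<^bsub>sym_algebra L\<^esub> sym_mon L N))
           \<oplus>\<^bsub>sym_algebra L\<^esub> act2 L act (tl_ang L (bas (l, m))) (sym_mon L N)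
           \<oplus>\<^bsub>sym_algebra L\<^esub> act (tl_br L (bas (l, m))) (sym_mon L N)"
      using conjunct2[OF conjunct2[OF conjunct2[OF conjunct2[OF conjunct2[OF C]]]]] l by simp
    also have "\<dots> = sym_class L (rhs (act_words act) l m N)"
      using l by (intro represents_rhs(1)[OF rep]) auto
    finally show "act_words act l (m # N) = rhs (act_words act) l m N"
      using l represents_rhs(2)[OF rep, of l m N] by (simp add: act_words_def sym_mon_sorted sym_rep_sorted)
  qed
qed

section \<open>Adequacy as an identity in the free module\<close>

lemma tens_simps [simp]: "tens (bas x) (bas y) = bas (x, y)" "tens u 0 = 0" "tens 0 v = 0"
  by (simp_all add: tens_def lin_ext_def[of "\<lambda>_. 0"])

lemma op2_add: "op2 A (s + t) f = op2 A s f + op2 A t f"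
  and op2_zero: "op2 A 0 f = 0"
  and op2_scale_bas: "op2 A (scale c (bas (a, b))) f = scale c (lin_ext (A a) (lin_ext (A b) f))"
  by (simp_all add: op2_def lin_ext_add lin_ext_scale lin_ext_single)

text \<open>The terms with \<open>[,]\<close> vanish and \<open>T\<close> splits into
  \<open>S\<close> and the angle bracket. Combinations of sorted words are equal if their classes
  are, which carries the hypothesis over from the quotient.\<close>

lemma adequate_forI:
  assumes A: "represents A act"
    and identity: "\<And>r l m g N. (\<And>x y M. x \<in> B \<Longrightarrow> y \<in> B \<Longrightarrow> M \<in> sorted_words \<Longrightarrow> \<eta> x + \<eta> y + \<eta>s M \<le> r \<Longrightarrow>
         lin_ext (A x) (A y M) = scale (q x y) (lin_ext (A y) (A x M)) + op2 A (tl_ang L (bas (x, y))) (bas M)) \<Longrightarrow>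
       l \<in> B \<Longrightarrow> m \<in> B \<Longrightarrow> g \<in> B \<Longrightarrow> N \<in> sorted_words \<Longrightarrow> m < l \<Longrightarrow> g < m \<Longrightarrow>
       \<eta> l + \<eta> m + \<eta> g + \<eta>s N \<le> r + 1 \<Longrightarrow>
       op2 A (tl_ang L (bas (l, m))) (A g N) =
         scale (q m g * q l g) (lin_ext (A g) (op2 A (tl_ang L (bas (l, m))) (bas N)))
         + scale (q m g) (op2 A (tl_ang L (bas (l, g))) (A m N))
         - scale (q l m) (lin_ext (A m) (op2 A (tl_ang L (bas (l, g))) (bas N)))
         + lin_ext (A l) (op2 A (tl_ang L (bas (m, g))) (bas N))
         - scale (q l m * q l g) (op2 A (tl_ang L (bas (m, g))) (A l N))"
  shows "adequate_for L act"
proof -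
  have AB: "A x w \<in> free_on sorted_words" if "x \<in> B" "w \<in> sorted_words" for x w
    using A that by (auto simp: represents_def)
  have a1: "act (bas x) (sym_class L f) = sym_class L (lin_ext (A x) f)" "lin_ext (A x) f \<in> free_on sorted_words"
    if "x \<in> B" "f \<in> free_on sorted_words" for x f
    using represents_act[OF A that] by auto
  have a2: "act2 L act (tl_ang L (bas (x, y))) (sym_class L f) = sym_class L (op2 A (tl_ang L (bas (x, y))) f)"
    "op2 A (tl_ang L (bas (x, y))) f \<in> free_on sorted_words"
    if "x \<in> B" "y \<in> B" "f \<in> free_on sorted_words" for x y f
    using represents_act2[OF A ang_closed that(3)] that by auto
  have a0: "act 0 (sym_class L f) = sym_class L 0" "act2 L act 0 (sym_class L f) = sym_class L 0"
    if "f \<in> free_on sorted_words" for f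
    using A that represents_act2[OF A free_on_zero that] by (auto simp: represents_def sorted_free_on op2_zero)
  have b: "bas w \<in> free_on sorted_words" if "w \<in> sorted_words" for w using that by simp
  show ?thesis
    unfolding adequate_for_def Let_def ordered_seq_iff
  proof (intro allI impI ballI)
    fix r l m g N
    assume hyp: "\<forall>l'\<in>B. \<forall>\<mu>'\<in>B. \<forall>M. M \<in> sorted_words \<and> \<eta> l' + \<eta> \<mu>' + \<eta>s M \<le> r \<longrightarrow>
         act (bas l') (act (bas \<mu>') (sym_mon L M)) \<ominus>\<^bsub>sym_algebra L\<^esub> act2 L act (tl_T L (bas (l', \<mu>'))) (sym_mon L M)
         = act (tl_br L (tens (bas l') (bas \<mu>'))) (sym_mon L M)"
      and B: "l \<in> B" "m \<in> B" "g \<in> B"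
      and N: "m < l \<and> g < m \<and> N \<in> sorted_words \<and> le_seq g N \<and> \<eta> l + \<eta> m + \<eta> g + \<eta>s N \<le> r + 1"
    have rel: "lin_ext (A x) (A y M) = scale (q x y) (lin_ext (A y) (A x M)) + op2 A (tl_ang L (bas (x, y))) (bas M)"
      if xy: "x \<in> B" "y \<in> B" "M \<in> sorted_words" "\<eta> x + \<eta> y + \<eta>s M \<le> r" for x y M
    proof -
      have T: "tl_T L (bas (x, y)) \<in> free_on (B \<times> B)"
        using xy by (auto simp: T_bas intro!: free_on_add ang_closed)
      note t2 = represents_act2[OF A T b[OF xy(3)]]
      have "act (bas x) (act (bas y) (sym_mon L M)) \<ominus>\<^bsub>sym_algebra L\<^esub> act2 L act (tl_T L (bas (x, y))) (sym_mon L M)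
         = act (tl_br L (tens (bas x) (bas y))) (sym_mon L M)"
        using hyp xy by blast
      then have "sym_class L (lin_ext (A x) (A y M) - op2 A (tl_T L (bas (x, y))) (bas M)) = sym_class L 0"
        using xy b[OF xy(3)] AB t2 a1 a0 by (simp add: br_zero sym_mon_sorted sym_class_diff sorted_free_on)
      then have "nf (lin_ext (A x) (A y M) - op2 A (tl_T L (bas (x, y))) (bas M)) = nf 0"
        using xy AB t2 a1 by (subst (asm) sym_class_eq_iff) (auto intro!: sorted_free_on free_on_diff)
      then have "lin_ext (A x) (A y M) - op2 A (tl_T L (bas (x, y))) (bas M) = 0"
        using xy AB t2 a1 by (subst (asm) nf_free_on_sorted) (auto intro!: free_on_diff)
      then show ?thesis using xy by (simp add: T_bas op2_add op2_scale_bas del: scale_bas)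
    qed
    have fs: "A g N \<in> free_on sorted_words" "A m N \<in> free_on sorted_words" "A l N \<in> free_on sorted_words"
      "bas N \<in> free_on sorted_words"
      using B N AB b by auto
    note cl = a2(2)[OF B(1,2) fs(1)] a2(2)[OF B(1,2) fs(4)] a2(2)[OF B(1,3) fs(2)] a2(2)[OF B(1,3) fs(4)]
      a2(2)[OF B(2,3) fs(4)] a2(2)[OF B(2,3) fs(3)]
    note cl = cl a1(2)[OF B(3) cl(2)] a1(2)[OF B(2) cl(4)] a1(2)[OF B(1) cl(5)]
    have *: "act2 L act (tl_ang L (bas (l, m))) (act (bas g) (sym_mon L N)) = sym_class L (op2 A (tl_ang L (bas (l, m))) (A g N))"
      using B N fs by (simp add: sym_mon_sorted a1 a2)
    show "act2 L act (tl_ang L (tens (bas l) (bas m))) (act (bas g) (sym_mon L N)) \<ominus>\<^bsub>sym_algebra L\<^esub>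
          sym_scale L (q l m) (act (tl_br L (tens (bas m) (tl_br L (tens (bas l) (bas g))))) (sym_mon L N))
       = sym_scale L (q m g * q l g) (act2 L act (tl_ang L (tens (bas g) (tl_br L (tens (bas l) (bas m))))) (sym_mon L N)) \<oplus>\<^bsub>sym_algebra L\<^esub>
         sym_scale L (q m g * q l g) (act (bas g) (act2 L act (tl_ang L (tens (bas l) (bas m))) (sym_mon L N))) \<oplus>\<^bsub>sym_algebra L\<^esub>
         sym_scale L (q m g) (act2 L act (tl_ang L (tens (bas l) (bas g))) (act (bas m) (sym_mon L N))) \<ominus>\<^bsub>sym_algebra L\<^esub>
         sym_scale L (q l m) (act (bas m) (act2 L act (tl_ang L (tens (bas l) (bas g))) (sym_mon L N))) \<oplus>\<^bsub>sym_algebra L\<^esub>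
         sym_scale L (q m g) (act (tl_br L (tens (bas l) (bas g))) (act (bas m) (sym_mon L N))) \<ominus>\<^bsub>sym_algebra L\<^esub>
         sym_scale L (q l m) (act (bas m) (act (tl_br L (tens (bas l) (bas g))) (sym_mon L N))) \<oplus>\<^bsub>sym_algebra L\<^esub>
         act (bas l) (act2 L act (tl_ang L (tens (bas m) (bas g))) (sym_mon L N)) \<ominus>\<^bsub>sym_algebra L\<^esub>
         sym_scale L (q l m * q l g) (act2 L act (tl_ang L (tens (bas m) (bas g))) (act (bas l) (sym_mon L N))) \<ominus>\<^bsub>sym_algebra L\<^esub>
         sym_scale L (q l g * q l m) (act2 L act (tl_ang L (tens (tl_br L (tens (bas m) (bas g))) (bas l))) (sym_mon L N))"
      using B N fs cl identity[OF rel, of r l m g N]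
      by (simp add: sym_mon_sorted br_zero ang_zero a0 a1 a2 sym_class_scale sym_class_add sym_class_diff
          sorted_free_on free_on_scale free_on_add free_on_diff)
  qed
qed

text \<open>The hypothesis of adequacy speaks of monomials, whereas \<open>A z N\<close> is a
  combination of them. The words of \<open>f\<close> have degree at most \<open>s - 1\<close>, which
  explains the bound \<open>r + 1\<close>.\<close>

lemma relation_extends:
  assumes rel: "\<And>M. M \<in> sorted_words \<Longrightarrow> \<eta> x + \<eta> y + \<eta>s M \<le> r \<Longrightarrow>
      lin_ext (A x) (A y M) = scale (q x y) (lin_ext (A y) (A x M)) + op2 A (tl_ang L (bas (x, y))) (bas M)"
    and f: "f \<in> low s" "\<eta> x + \<eta> y + s \<le> r + 1"
  shows "lin_ext (A x) (lin_ext (A y) f) =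
    scale (q x y) (lin_ext (A y) (lin_ext (A x) f)) + op2 A (tl_ang L (bas (x, y))) f"
proof -
  have op: "op2 A t f = lin_ext (\<lambda>w. op2 A t (bas w)) f" for t
    by (simp add: op2_def case_prod_unfold lin_ext_comp lin_ext_swap[of _ f])
  have "lin_ext (A x) (lin_ext (A y) f) =
    lin_ext (\<lambda>w. scale (q x y) (lin_ext (A y) (A x w)) + op2 A (tl_ang L (bas (x, y))) (bas w)) f"
    unfolding lin_ext_comp using f by (intro lin_ext_cong rel) (auto simp: low_def dest!: free_onD)
  then show ?thesis by (simp add: lin_ext_fun_add op lin_ext_comp scale_lin_ext)
qed

end

section \<open>The identity of adequacy\<close>

lemma less_Z [simp]: "Z u v < Z i j \<longleftrightarrow> u < i \<or> u = i \<and> v < j"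
  by (auto simp: less_Zgen_def)

text \<open>The coefficient of \<open>\<langle>x,y\<rangle> \<cdot> f\<close> if \<open>F a b\<close> is that of \<open>a \<cdot> b \<cdot> f\<close>.\<close>

fun ang_val :: "'k::comm_ring_1 \<Rightarrow> 'k \<Rightarrow> (nat \<Rightarrow> nat \<Rightarrow> 'k) \<Rightarrow> Zgen \<Rightarrow> Zgen \<Rightarrow> (Zgen \<Rightarrow> Zgen \<Rightarrow> 'k) \<Rightarrow> 'k" where
  "ang_val p q \<epsilon> (Z i l) (Z u v) F =
     (if i > u \<and> l > v then \<epsilon> v l * (p - unit_inv q) * F (Z i v) (Z u l) else 0)"

text \<open>
  \<open>w x y z\<close> stands for a coefficient of \<open>x \<cdot> y \<cdot> z \<cdot> z\<^sub>N\<close>, and \<open>R12\<close>, \<open>R23\<close> for the relation \<open>x \<cdot> y = T(x \<otimes> y)\<close> in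
  degrees below \<open>D\<close>.  Rewriting with these rules sorts the lower indices of every word.
\<close>

lemma adequacy_scalar:
  fixes w :: "Zgen \<Rightarrow> Zgen \<Rightarrow> Zgen \<Rightarrow> 'k::comm_ring_1" and \<eta> :: "Zgen \<Rightarrow> nat"
  assumes units: "p * unit_inv p = 1" "q * unit_inv q = 1"
    and eps: "\<And>i j. i \<in> I \<union> J \<Longrightarrow> j \<in> I \<union> J \<Longrightarrow> \<epsilon> i j * \<epsilon> i j = 1"
    and sym: "\<And>i j. i \<in> I \<union> J \<Longrightarrow> j \<in> I \<union> J \<Longrightarrow> \<epsilon> i j = \<epsilon> j i"
    and deg: "\<And>i u l v. u < i \<Longrightarrow> i \<in> I \<Longrightarrow> u \<in> I \<Longrightarrow> v \<in> J \<Longrightarrow> l \<in> J \<Longrightarrow> v < l \<Longrightarrow> \<eta> (Z i v) + \<eta> (Z u l) < \<eta> (Z i l) + \<eta> (Z u v)"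
    and R12: "\<And>i l u v z. Z u v < Z i l \<Longrightarrow> i \<in> I \<Longrightarrow> u \<in> I \<Longrightarrow> l \<in> J \<Longrightarrow> v \<in> J \<Longrightarrow> z \<in> B \<Longrightarrow>
       \<eta> (Z i l) + \<eta> (Z u v) + \<eta> z < D \<Longrightarrow>
       w (Z i l) (Z u v) z
      = q_gt p q \<epsilon> (Z i l) (Z u v) * w (Z u v) (Z i l) z
        + ang_val p q \<epsilon> (Z i l) (Z u v) (\<lambda>a b. w a b z)"
    and R23: "\<And>i l u v z. Z u v < Z i l \<Longrightarrow> i \<in> I \<Longrightarrow> u \<in> I \<Longrightarrow> l \<in> J \<Longrightarrow> v \<in> J \<Longrightarrow> z \<in> B \<Longrightarrow>
       \<eta> z + \<eta> (Z i l) + \<eta> (Z u v) < D \<Longrightarrow>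
       w z (Z i l) (Z u v)
      = q_gt p q \<epsilon> (Z i l) (Z u v) * w z (Z u v) (Z i l)
        + ang_val p q \<epsilon> (Z i l) (Z u v) (\<lambda>a b. w z a b)"
    and B: "\<And>i l. Z i l \<in> B \<longleftrightarrow> i \<in> I \<and> l \<in> J"
    and xyz: "x \<in> B" "y \<in> B" "z \<in> B" "y < x" "z < y" "\<eta> x + \<eta> y + \<eta> z \<le> D"
  shows "ang_val p q \<epsilon> x y (\<lambda>a b. w a b z)
    = q_gt p q \<epsilon> y z * q_gt p q \<epsilon> x z * ang_val p q \<epsilon> x y (\<lambda>a b. w z a b)
    + q_gt p q \<epsilon> y z * ang_val p q \<epsilon> x z (\<lambda>a b. w a b y)
    - q_gt p q \<epsilon> x y * ang_val p q \<epsilon> x z (\<lambda>a b. w y a b)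
    + ang_val p q \<epsilon> y z (\<lambda>a b. w x a b)
    - q_gt p q \<epsilon> x y * q_gt p q \<epsilon> x z * ang_val p q \<epsilon> y z (\<lambda>a b. w a b x)"
proof -
  obtain i l where x: "x = Z i l" by (cases x)
  obtain u v where y: "y = Z u v" by (cases y)
  obtain a b where z: "z = Z a b" by (cases z)
  define pi where "pi = unit_inv p"
  define qi where "qi = unit_inv q"
  \<comment> \<open>Each cancellation is also stated with a trailing factor, so that it applies
    inside right-nested products.\<close>
  have un: "p * pi = 1" "p * (pi * c) = c" "q * qi = 1" "q * (qi * c) = c" for c
    using units by (simp_all add: pi_def qi_def flip: mult.assoc)
  have mem: "i \<in> I" "u \<in> I" "a \<in> I" "l \<in> J" "v \<in> J" "b \<in> J"
    using xyz B by (auto simp: x y z)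
  have eps2: "\<epsilon> i j * (\<epsilon> i j * c) = c" if "i \<in> I \<union> J" "j \<in> I \<union> J" for i j c
    using eps[OF that] by (simp flip: mult.assoc)
  have D: "\<eta> (Z i l) + \<eta> (Z u v) + \<eta> (Z a b) \<le> D"
    using xyz by (simp add: x y z)

  \<comment> \<open>The words whose lower indices are a permutation of \<open>(i, u, a)\<close>, with upper indices \<open>c, d, e\<close> over
    \<open>i, u, a\<close>, have a degree that depends only on \<open>(c, d, e)\<close>: no arithmetic is left in the rewriting.\<close>
  define ok where "ok c d e \<longleftrightarrow> \<eta> (Z i c) + \<eta> (Z u d) + \<eta> (Z a e) < D" for c d e
  \<comment> \<open>\<open>R\<close>, \<open>R2\<close>, \<open>R3\<close> treat the pairs of lower
    indices \<open>(i, u)\<close>, \<open>(i, a)\<close>, \<open>(u, a)\<close>, each once before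
    and once after the third letter.\<close>
  have R: "ok c d e \<Longrightarrow> w (Z i c) (Z u d) (Z a e)
      = q_gt p q \<epsilon> (Z i c) (Z u d) * w (Z u d) (Z i c) (Z a e)
        + ang_val p q \<epsilon> (Z i c) (Z u d) (\<lambda>x y. w x y (Z a e))"
     "ok c d e \<Longrightarrow> w (Z a e) (Z i c) (Z u d)
      = q_gt p q \<epsilon> (Z i c) (Z u d) * w (Z a e) (Z u d) (Z i c)
        + ang_val p q \<epsilon> (Z i c) (Z u d) (w (Z a e))"
    if "c \<in> J" "d \<in> J" "e \<in> J" "Z u d < Z i c" for c d e
    using that mem B by - ((rule R12 | rule R23); simp add: ok_def B add_ac del: less_Z)+
  have R2: "ok c d e \<Longrightarrow> w (Z i c) (Z a e) (Z u d)
      = q_gt p q \<epsilon> (Z i c) (Z a e) * w (Z a e) (Z i c) (Z u d)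
        + ang_val p q \<epsilon> (Z i c) (Z a e) (\<lambda>x y. w x y (Z u d))"
     "ok c d e \<Longrightarrow> w (Z u d) (Z i c) (Z a e)
      = q_gt p q \<epsilon> (Z i c) (Z a e) * w (Z u d) (Z a e) (Z i c)
        + ang_val p q \<epsilon> (Z i c) (Z a e) (w (Z u d))"
    if "c \<in> J" "d \<in> J" "e \<in> J" "Z a e < Z i c" for c d e
    using that mem B by - ((rule R12 | rule R23); simp add: ok_def B add_ac del: less_Z)+
  have R3: "ok c d e \<Longrightarrow> w (Z u d) (Z a e) (Z i c)
      = q_gt p q \<epsilon> (Z u d) (Z a e) * w (Z a e) (Z u d) (Z i c)
        + ang_val p q \<epsilon> (Z u d) (Z a e) (\<lambda>x y. w x y (Z i c))"
     "ok c d e \<Longrightarrow> w (Z i c) (Z u d) (Z a e)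
      = q_gt p q \<epsilon> (Z u d) (Z a e) * w (Z i c) (Z a e) (Z u d)
        + ang_val p q \<epsilon> (Z u d) (Z a e) (w (Z i c))"
    if "c \<in> J" "d \<in> J" "e \<in> J" "Z a e < Z u d" for c d e
    using that mem B by - ((rule R12 | rule R23); simp add: ok_def B add_ac del: less_Z)+
  have ord: "u < i \<or> i = u \<and> v < l" "a < u \<or> a = u \<and> b < v"
    using xyz by (auto simp: x y z)
  \<comment> \<open>The lower indices decrease weakly, so the cases differ in which neighbours
    coincide. If all three agree, every angle bracket is zero.\<close>
  then consider "u < i" "a < u" "a < i" | "u < i" "a = u" "b < v" | "i = u" "v < l" "a < u" | "i = u" "a = u" "v < l" "b < v"
    by (elim disjE conjE) auto
  then show ?thesis
  proof cases
    case 1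
    note so = 1 1[THEN less_not_sym] 1[THEN less_imp_neq] 1[THEN less_imp_neq, symmetric]
    note dd = deg[OF 1(1) mem(1,2)] deg[OF 1(2) mem(2,3)] deg[OF 1(3) mem(1,3)]
    \<comment> \<open>Each of these words arises from the upper indices \<open>(l, v, b)\<close> by
      one or two exchanges that put the smaller upper index over the larger lower one; each exchange
      lowers the degree.\<close>
    have f: "v < l \<Longrightarrow> ok v l b" "b < l \<Longrightarrow> ok b v l" "b < v \<Longrightarrow> ok l b v"
      "v < l \<Longrightarrow> b < l \<Longrightarrow> ok v b l" "v < l \<Longrightarrow> b < v \<Longrightarrow> ok v b l"
      "b < l \<Longrightarrow> l < v \<Longrightarrow> ok b l v" "b < l \<Longrightarrow> b < v \<Longrightarrow> ok b l v"
      using dd[of v l] dd[of b v] dd[of b l] dd[of l v] D mem unfolding ok_def by auto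
    \<comment> \<open>These are the thirteen weak orderings of \<open>l\<close>, \<open>v\<close>,
      \<open>b\<close>.\<close>
    consider "b < v" "v < l" "b < l" | "b < l" "l < v" "b < v" | "v < b" "b < l" "v < l" | "v < l" "l < b" "v < b"
      | "l < b" "b < v" "l < v" | "l < v" "v < b" "l < b" | "b < l" "v = b" "v < l" | "b < l" "v = l" "b < v"
      | "v < l" "b = l" "v < b" | "l < v" "b = l" "b < v" | "l < b" "v = b" "l < v" | "l < b" "v = l" "v < b" | "l = v" "b = v"
      by (cases l v rule: linorder_cases; cases l b rule: linorder_cases; cases v b rule: linorder_cases; force)
    then show ?thesis unfolding x y z
      apply cases
      apply (insert f)
      \<comment> \<open>\<open>R(1)\<close> and \<open>R3(2)\<close> match the same words; leaving
        out the latter fixes one route to the sorted word.\<close>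
      apply (simp_all add: so mem R R2 R3(1)
        less_imp_not_less less_imp_not_eq less_imp_not_eq2 pi_def[symmetric] qi_def[symmetric])
      \<comment> \<open>A ring identity in the coefficients of the sorted words is left. As an
        ordered rewrite rule, \<open>sym\<close> normalises the arguments of \<epsilon>.\<close>
      apply (simp_all only: mult_1_left mult_1_right un eps eps2 mem sym Un_iff simp_thms algebra_simps)
      done
  next
    case 2
    note so = 2 2(1,3)[THEN less_not_sym] 2(1,3)[THEN less_imp_neq] 2(1,3)[THEN less_imp_neq, symmetric]
    note dd = deg[OF 2(1) mem(1,2)]
    have f: "v < l \<Longrightarrow> ok v l b" "v < l \<Longrightarrow> ok v b l" "b < l \<Longrightarrow> ok b l v" "b < l \<Longrightarrow> ok b v l"
      using dd[of v l] dd[of b v] dd[of b l] D 2 mem unfolding ok_def by auto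
    consider "v < l" "b < l" | "b < l" "l = v" | "b < l" "l < v" | "b = l" "l < v" | "l < b" "l < v"
      using 2(3) by linarith
    \<comment> \<open>Here the constant \<open>p - unit_inv q\<close> shows its origin. For
      \<open>b < v < l\<close> and all signs 1, let h be the factor in the angle bracket: the
      coefficients of the word \<open>Z u v\<close>, \<open>Z u l\<close>, \<open>Z i b\<close>
      agree precisely when h^2 = h (p - q^(-1)).\<close>
    then show ?thesis unfolding x y z
      apply cases
      apply (insert f)
      apply (simp_all add: so mem R[unfolded 2(2)] R2[unfolded 2(2)] R3[unfolded 2(2)]
        less_imp_not_less less_imp_not_eq less_imp_not_eq2 pi_def[symmetric] qi_def[symmetric])
      apply (simp_all only: mult_1_left mult_1_right un eps eps2 mem sym Un_iff simp_thms algebra_simps)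
      done
  next
    case 3
    note so = 3 3(2,3)[THEN less_not_sym] 3(2,3)[THEN less_imp_neq] 3(2,3)[THEN less_imp_neq, symmetric]
    note dd = deg[OF 3(3) mem(2,3)]
    have f: "b < l \<Longrightarrow> ok b v l" "b < l \<Longrightarrow> ok v b l" "b < v \<Longrightarrow> ok l b v" "b < v \<Longrightarrow> ok b l v"
      using dd[of v l] dd[of b v] dd[of b l] D 3 mem unfolding ok_def by auto
    consider "b < v" "b < l" | "b = v" "v < l" | "v < b" "b < l" | "b = l" "v < l" | "l < b" "v < b"
      using 3(2) by linarith
    then show ?thesis unfolding x y z
      apply cases
      apply (insert f)
      apply (simp_all add: so mem R[unfolded 3(1)] R2[unfolded 3(1)] R3[unfolded 3(1)]
        less_imp_not_less less_imp_not_eq less_imp_not_eq2 pi_def[symmetric] qi_def[symmetric])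
      apply (simp_all only: mult_1_left mult_1_right un eps eps2 mem sym Un_iff simp_thms algebra_simps)
      done
  next
    case 4
    then show ?thesis by (simp add: x y z)
  qed
qed

section \<open>The algebras \<open>L\<^bsub>p,q,\<epsilon>\<^esub>(n,m,k)\<close>\<close>

text \<open>Existence collects the terms of \<open>v\<close> by degree. Uniqueness compares
  coefficients: the one at \<open>x\<close> can only come from the component of degree
  \<open>d x\<close>.\<close>

lemma direct_sum_decomp_free_on:
  fixes B :: "'b set" and d :: "'b \<Rightarrow> nat"
  assumes d: "\<And>x. x \<in> B \<Longrightarrow> d x \<ge> 1"
  shows "direct_sum_decomp (free_on B :: ('b \<Rightarrow>\<^sub>0 'k::comm_ring_1) set) (\<lambda>e. free_on {x \<in> B. d x = e})"
  unfolding direct_sum_decomp_def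
proof (intro conjI allI impI ballI)
  fix v :: "'b \<Rightarrow>\<^sub>0 'k" assume v: "v \<in> free_on B"
  let ?P = "\<lambda>c :: nat \<Rightarrow>\<^sub>0 ('b \<Rightarrow>\<^sub>0 'k). 0 \<notin> Poly_Mapping.keys c \<and>
    (\<forall>e\<ge>1. Poly_Mapping.lookup c e \<in> free_on {x \<in> B. d x = e}) \<and>
    v = (\<Sum>e\<in>Poly_Mapping.keys c. Poly_Mapping.lookup c e)"
  define c where "c = (\<Sum>x\<in>Poly_Mapping.keys v. Poly_Mapping.single (d x) (Poly_Mapping.single x (Poly_Mapping.lookup v x)))"
  have c: "Poly_Mapping.lookup c e = (\<Sum>x\<in>Poly_Mapping.keys v. Poly_Mapping.single x (Poly_Mapping.lookup v x) when d x = e)" for e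
    by (simp add: c_def lookup_sum lookup_single)
  have "Poly_Mapping.lookup c 0 = 0"
    unfolding c using d v by (intro sum.neutral) (force simp: when_def dest: free_onD)
  moreover have "Poly_Mapping.lookup c e \<in> free_on {x \<in> B. d x = e}" for e
    unfolding c using v by (intro free_on_sum) (auto simp: when_def dest: free_onD)
  moreover have "v = (\<Sum>e\<in>Poly_Mapping.keys c. Poly_Mapping.lookup c e)"
  proof -
    \<comment> \<open>\<open>?K\<close> contains all degrees that occur in \<open>v\<close>, so the
      keys of \<open>c\<close> need not be determined.\<close>
    let ?K = "Poly_Mapping.keys c \<union> d ` Poly_Mapping.keys v"
    have "(\<Sum>e\<in>Poly_Mapping.keys c. Poly_Mapping.lookup c e) = (\<Sum>e\<in>?K. Poly_Mapping.lookup c e)"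
      by (intro sum.mono_neutral_left) (auto simp: in_keys_iff)
    also have "\<dots> = (\<Sum>x\<in>Poly_Mapping.keys v. \<Sum>e\<in>?K. Poly_Mapping.single x (Poly_Mapping.lookup v x) when d x = e)"
      unfolding c by (rule sum.swap)
    also have "\<dots> = (\<Sum>x\<in>Poly_Mapping.keys v. Poly_Mapping.single x (Poly_Mapping.lookup v x))"
      by (intro sum.cong) (auto simp: when_def)
    also have "\<dots> = v" using lin_ext_id[of v] unfolding lin_ext_def by simp
    finally show ?thesis by simp
  qed
  ultimately have Pc: "?P c" by (simp only: in_keys_iff not_not simp_thms)
  have unique: "Poly_Mapping.lookup (Poly_Mapping.lookup c' e) x = (if x \<in> B \<and> d x = e then Poly_Mapping.lookup v x else 0)"
    if c': "?P c'" for c' e x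
  proof -
    note c1 = conjunct1[OF c'] and c2 = conjunct1[OF conjunct2[OF c']] and c3 = conjunct2[OF conjunct2[OF c']]
    have z: "Poly_Mapping.lookup (Poly_Mapping.lookup c' e) x = 0" if "\<not> (x \<in> B \<and> d x = e)" for e
    proof (cases "e = 0")
      case True
      then show ?thesis using c1 by (simp add: in_keys_iff)
    next
      case False
      then have "Poly_Mapping.lookup c' e \<in> free_on {x \<in> B. d x = e}" using c2 by simp
      then show ?thesis using that by (auto simp: free_on_def in_keys_iff)
    qed
    have "Poly_Mapping.lookup v x = (\<Sum>e\<in>Poly_Mapping.keys c'. Poly_Mapping.lookup (Poly_Mapping.lookup c' e) x)"
      by (subst c3) (rule lookup_sum)
    also have "\<dots> = (\<Sum>e\<in>Poly_Mapping.keys c' \<union> {d x}. Poly_Mapping.lookup (Poly_Mapping.lookup c' e) x)"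
      by (intro sum.mono_neutral_left) (auto simp: in_keys_iff)
    also have "\<dots> = (\<Sum>e\<in>{d x}. Poly_Mapping.lookup (Poly_Mapping.lookup c' e) x)"
      using z by (intro sum.mono_neutral_right) auto
    finally have "Poly_Mapping.lookup v x = Poly_Mapping.lookup (Poly_Mapping.lookup c' (d x)) x" by simp
    then show ?thesis using z by auto
  qed
  show "\<exists>!c. ?P c"
  proof (rule ex1I[of ?P, OF Pc])
    fix c' assume "?P c'"
    show "c' = c"
      by (intro poly_mapping_eqI) (simp only: unique[OF Pc] unique[OF \<open>?P c'\<close>])
  qed
next
  fix e
  show "free_mod.subspace (free_on {x \<in> B. d x = e} :: ('b \<Rightarrow>\<^sub>0 'k) set)" by (rule free_on_subspace)
  show "(free_on {x \<in> B. d x = e} :: ('b \<Rightarrow>\<^sub>0 'k) set) \<subseteq> free_on B" unfolding free_on_def by blast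
qed

lemma tens_free_on:
  "u \<in> free_on X \<Longrightarrow> v \<in> free_on Y \<Longrightarrow> tens u v \<in> free_on (X \<times> Y)"
  unfolding tens_def by (intro lin_ext_free_on[of _ X] lin_ext_free_on[of _ Y]) auto

lemma tens_span_free_on: "tens_span (free_on X) (free_on Y) \<subseteq> free_on (X \<times> Y)"
  unfolding tens_span_def
  by (rule free_mod.span_minimal) (auto simp: free_on_subspace intro: tens_free_on)

lemma unit_inv: "c dvd 1 \<Longrightarrow> c * unit_inv c = (1 :: 'k::comm_ring_1)"
proof -
  assume "c dvd 1"
  then obtain d where d: "c * d = 1" by (elim dvdE) simp
  have "e = d" if e: "c * e = 1" for e
  proof -
    have "e = e * (c * d)" using d by simp
    also have "\<dots> = (c * e) * d" by (simp add: mult_ac)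
    also have "\<dots> = d" using e by simp
    finally show ?thesis .
  qed
  then have "unit_inv c = d" unfolding unit_inv_def using d by (intro the_equality) blast+
  with d show ?thesis by simp
qed

lemma unit_mult: "a dvd 1 \<Longrightarrow> b dvd 1 \<Longrightarrow> a * b dvd (1 :: 'k::comm_ring_1)"
  using mult_dvd_mono[of a 1 b 1] by simp

lemma sign_square: "e = 1 \<or> e = -1 \<Longrightarrow> e * e = (1 :: 'k::comm_ring_1)"
  by auto

text \<open>Lower and upper indices both occur as arguments of \<epsilon>, hence the union of the
  two ranges. \<open>nontrivial\<close> makes basis vectors nonzero, so that their degrees are
  determined.\<close>

locale Lpq_parameters =
  fixes p q :: "'k::comm_ring_1" and \<epsilon> :: "nat \<Rightarrow> nat \<Rightarrow> 'k" and n m :: nat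
  assumes unit_p: "p dvd 1" and unit_q: "q dvd 1" and nontrivial: "(1 :: 'k) \<noteq> 0"
    and eps_square: "\<And>i j. i \<in> {1..n} \<union> {1..m} \<Longrightarrow> j \<in> {1..n} \<union> {1..m} \<Longrightarrow> \<epsilon> i j * \<epsilon> i j = 1"
    and eps_commute: "\<And>i j. i \<in> {1..n} \<union> {1..m} \<Longrightarrow> j \<in> {1..n} \<union> {1..m} \<Longrightarrow> \<epsilon> i j = \<epsilon> j i"
begin

abbreviation "L \<equiv> Lpq p q \<epsilon> n m"

fun deg :: "Zgen \<Rightarrow> nat" where
  "deg (Z i j) = i * 3 ^ (j - 1)"

lemma basis: "tl_basis L = {Z i j | i j. 1 \<le> i \<and> i \<le> n \<and> 1 \<le> j \<and> j \<le> m}"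
  by (simp add: Lpq_def)

lemma Z_in_basis [simp]: "Z i j \<in> tl_basis L \<longleftrightarrow> i \<in> {1..n} \<and> j \<in> {1..m}"
  by (auto simp: basis)

lemma deg_pos: "x \<in> tl_basis L \<Longrightarrow> deg x \<ge> 1"
  by (cases x) auto

lemma comp: "tl_comp L = (\<lambda>e. free_on {x \<in> tl_basis L. deg x = e})"
proof
  fix e
  have "{Z j i | i j. 1 \<le> j \<and> j \<le> n \<and> 1 \<le> i \<and> i \<le> m \<and> j * 3 ^ (i - 1) = e} = {x \<in> tl_basis L. deg x = e}"
    by (auto simp: basis)
  then show "tl_comp L e = free_on {x \<in> tl_basis L. deg x = e}" by (simp add: Lpq_def)
qed

lemma eta: "x \<in> tl_basis L \<Longrightarrow> tl_eta L x = deg x"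
  unfolding tl_eta_def comp using deg_pos[of x] nontrivial
  by (intro the_equality) (auto simp: free_on_def)

text \<open>The right side exceeds the left by (i - u)(3^(l-1) - 3^(v-1)). The condition on
  \<open>v\<close> excludes truncated subtraction in the exponents.\<close>

lemma deg_exchange:
  assumes "u < i" "v < l" "1 \<le> v"
  shows "deg (Z i v) + deg (Z u l) < deg (Z i l) + deg (Z u v)"
proof -
  have "(3::nat) ^ (v - 1) < 3 ^ (l - 1)" using assms by (intro power_strict_increasing) auto
  then obtain k where k: "3 ^ (l - 1) = 3 ^ (v - 1) + (k :: nat)" "k > 0"
    by (metis less_imp_add_positive)
  show ?thesis unfolding deg.simps k(1) using assms(1) k(2) by (simp add: algebra_simps)
qed

text \<open>For \<open>y < x\<close> one of the first four branches of \<open>q_gt\<close> applies,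
  and each is a product of signs, \<open>p\<close>, \<open>q\<close> and the inverse of
  \<open>p\<close>.\<close>

lemma q_gt_unit:
  assumes "x \<in> tl_basis L" "y \<in> tl_basis L" "y < x"
  shows "q_gt p q \<epsilon> x y dvd 1"
proof -
  obtain i l u v where x: "x = Z i l" and y: "y = Z u v" by (cases x, cases y)
  have e: "\<epsilon> a b dvd 1" if "a \<in> {1..n} \<union> {1..m}" "b \<in> {1..n} \<union> {1..m}" for a b
    using eps_square[OF that] by (metis dvdI)
  have "unit_inv p dvd 1" using unit_inv[OF unit_p] by (metis dvdI mult.commute)
  then show ?thesis using assms unit_p unit_q e unfolding x y
    by (auto intro!: unit_mult)
qed

lemma Lpq_q_inverse:
  assumes "x \<in> tl_basis L" "y \<in> tl_basis L"
  shows "Lpq_q p q \<epsilon> x y * Lpq_q p q \<epsilon> y x = 1"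
  using unit_inv[OF q_gt_unit[of x y]] unit_inv[OF q_gt_unit[of y x]] assms
  by (cases x y rule: linorder_cases) (auto simp: Lpq_q_def mult.commute)

lemma tl_q: "tl_q L x y = Lpq_q p q \<epsilon> x y"
  by (simp add: tl_q_def Lpq_def Lpq_S_def)

lemma ang_gt_degree:
  assumes "x \<in> tl_basis L" "y \<in> tl_basis L" "y < x"
  shows "ang_gt p q \<epsilon> x y \<in> free_on {(a, b). a \<in> tl_basis L \<and> b \<in> tl_basis L \<and> deg a + deg b < deg x + deg y}"
proof -
  obtain i l u v where x: "x = Z i l" and y: "y = Z u v" by (cases x, cases y)
  show ?thesis
  proof (cases "u < i \<and> v < l")
    case True
    with assms have "(Z i v, Z u l) \<in> {(a, b). a \<in> tl_basis L \<and> b \<in> tl_basis L \<and> deg a + deg b < deg x + deg y}"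
      using deg_exchange[of u i v l] by (auto simp: x y simp del: deg.simps)
    then show ?thesis using True by (simp add: x y)
  qed (auto simp: x y)
qed

lemma ang_bas: "tl_ang L (bas (x, y)) =
    (if y < x then ang_gt p q \<epsilon> x y else if x = y then 0
     else - scale (unit_inv (q_gt p q \<epsilon> y x)) (ang_gt p q \<epsilon> y x))"
  by (simp add: Lpq_def Lpq_ang_def)

lemma ang_low:
  assumes "x \<in> tl_basis L" "y \<in> tl_basis L"
  shows "tl_ang L (bas (x, y)) \<in> free_on {(a, b). a \<in> tl_basis L \<and> b \<in> tl_basis L \<and> deg a + deg b < deg x + deg y}"
  using ang_gt_degree[of x y] ang_gt_degree[of y x] assms
  by (cases x y rule: linorder_cases)
    (auto simp: ang_bas add.commute intro!: free_on_uminus free_on_scale)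

sublocale filtered_q_commutative L
proof
  fix x y a b
  { assume xy: "x \<in> tl_basis L" "y \<in> tl_basis L"
    show "tl_S L (bas (x, y)) = scale (tl_q L x y) (bas (y, x))"
      unfolding tl_q by (simp add: Lpq_def Lpq_S_def)
    then show "tl_T L (bas (x, y)) = scale (tl_q L x y) (bas (y, x)) + tl_ang L (bas (x, y))"
      by (simp add: Lpq_def)
    show "tl_q L x y * tl_q L y x = 1" unfolding tl_q by (rule Lpq_q_inverse[OF xy])
    show "tl_ang L (bas (x, y)) \<in> free_on (tl_basis L \<times> tl_basis L)"
      by (rule free_on_mono[OF ang_low[OF xy]]) auto
    assume "(a, b) \<in> Poly_Mapping.keys (tl_ang L (bas (x, y)))"
    from free_onD[OF ang_low[OF xy] this] show "tl_eta L a + tl_eta L b < tl_eta L x + tl_eta L y"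
      using xy by (simp add: eta) }
  assume "x \<in> tl_basis L"
  then show "tl_q L x x = 1" "tl_eta L x > 0"
    using deg_pos[of x] by (simp_all add: tl_q Lpq_q_def eta)
qed (simp_all add: Lpq_def Lpq_ang_def)

lemma op2_ang: "y < x \<Longrightarrow> Poly_Mapping.lookup (op2 A (tl_ang L (bas (x, y))) f) t =
    ang_val p q \<epsilon> x y (\<lambda>a b. Poly_Mapping.lookup (lin_ext (A a) (lin_ext (A b) f)) t)"
  by (cases x; cases y) (auto simp: ang_bas op2_scale_bas op2_zero simp del: scale_bas)

lemma adequate: "adequate L"
  unfolding adequate_def
proof (intro conjI allI impI canonical_map_exists)
  fix act assume act: "canonical_map L act"
  define A where "A = act_words act"
  have can: "canonical A" unfolding A_def by (rule canonical_map_canonical[OF act])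
  show "adequate_for L act"
  proof (rule adequate_forI)
    show "represents A act" unfolding A_def by (rule canonical_map_represents[OF act])
  next
    fix r x y z N
    assume rel: "\<And>x y M. x \<in> B \<Longrightarrow> y \<in> B \<Longrightarrow> M \<in> sorted_words \<Longrightarrow> \<eta> x + \<eta> y + \<eta>s M \<le> r \<Longrightarrow>
         lin_ext (A x) (A y M) = scale (tl_q L x y) (lin_ext (A y) (A x M)) + op2 A (tl_ang L (bas (x, y))) (bas M)"
      and xyz: "x \<in> B" "y \<in> B" "z \<in> B" and N: "N \<in> sorted_words" and ord: "y < x" "z < y"
      and deg: "\<eta> x + \<eta> y + \<eta> z + \<eta>s N \<le> r + 1"
    have qq: "tl_q L a b = q_gt p q \<epsilon> a b" if "b < a" for a b
      using that by (simp add: tl_q Lpq_q_def)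
    have low: "A a N \<in> low (Suc (\<eta> a + \<eta>s N))" if "a \<in> B" for a
      by (rule leading_low[OF canonical_leading[OF can] that N lessI])
    have zx: "z < x" using ord by simp
    show "op2 A (tl_ang L (bas (x, y))) (A z N) =
         scale (tl_q L y z * tl_q L x z) (lin_ext (A z) (op2 A (tl_ang L (bas (x, y))) (bas N)))
         + scale (tl_q L y z) (op2 A (tl_ang L (bas (x, z))) (A y N))
         - scale (tl_q L x y) (lin_ext (A y) (op2 A (tl_ang L (bas (x, z))) (bas N)))
         + lin_ext (A x) (op2 A (tl_ang L (bas (y, z))) (bas N))
         - scale (tl_q L x y * tl_q L x z) (op2 A (tl_ang L (bas (y, z))) (A x N))"
    proof (rule poly_mapping_eqI)
      fix t
      \<comment> \<open>The coefficient at one fixed word \<open>t\<close>, which makes the identity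
        scalar.\<close>
      define w where "w = (\<lambda>a b c. Poly_Mapping.lookup (lin_ext (A a) (lin_ext (A b) (A c N))) t)"
      have op1: "Poly_Mapping.lookup (op2 A (tl_ang L (bas (a, b))) (A c N)) t = ang_val p q \<epsilon> a b (\<lambda>a b. w a b c)"
        if "b < a" for a b c
        using that by (simp add: op2_ang w_def)
      have op2: "Poly_Mapping.lookup (lin_ext (A c) (op2 A (tl_ang L (bas (a, b))) (bas N))) t = ang_val p q \<epsilon> a b (\<lambda>a b. w c a b)"
        if "b < a" for a b c
        using that by (cases a; cases b)
          (auto simp: ang_bas op2_scale_bas op2_zero lin_ext_scale w_def simp del: scale_bas)
      have "ang_val p q \<epsilon> x y (\<lambda>a b. w a b z)
          = q_gt p q \<epsilon> y z * q_gt p q \<epsilon> x z * ang_val p q \<epsilon> x y (\<lambda>a b. w z a b)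
          + q_gt p q \<epsilon> y z * ang_val p q \<epsilon> x z (\<lambda>a b. w a b y)
          - q_gt p q \<epsilon> x y * ang_val p q \<epsilon> x z (\<lambda>a b. w y a b)
          + ang_val p q \<epsilon> y z (\<lambda>a b. w x a b)
          - q_gt p q \<epsilon> x y * q_gt p q \<epsilon> x z * ang_val p q \<epsilon> y z (\<lambda>a b. w a b x)"
      \<comment> \<open>Degree below this \<open>D\<close> means that the three letters together
        with \<open>N\<close> have degree at most \<open>r\<close>, the range of the
        hypothesis.\<close>
      proof (rule adequacy_scalar[where I = "{1..n}" and J = "{1..m}" and B = B and \<eta> = \<eta> and D = "r + 1 - \<eta>s N"])
        fix i l u v z
        assume Z: "Z u v < Z i l" "i \<in> {1..n}" "u \<in> {1..n}" "l \<in> {1..m}" "v \<in> {1..m}" "z \<in> B"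
        { assume "\<eta> (Z i l) + \<eta> (Z u v) + \<eta> z < r + 1 - \<eta>s N"
          \<comment> \<open>The relation is applied to all words of \<open>A z N\<close>; by the
            leading term property their degree is at most that of \<open>z\<close> and
            \<open>N\<close> together.\<close>
          then have "lin_ext (A (Z i l)) (lin_ext (A (Z u v)) (A z N)) =
            scale (tl_q L (Z i l) (Z u v)) (lin_ext (A (Z u v)) (lin_ext (A (Z i l)) (A z N)))
             + op2 A (tl_ang L (bas (Z i l, Z u v))) (A z N)"
            using Z by (intro relation_extends[OF rel low]) auto
          then show "w (Z i l) (Z u v) z = q_gt p q \<epsilon> (Z i l) (Z u v) * w (Z u v) (Z i l) z
              + ang_val p q \<epsilon> (Z i l) (Z u v) (\<lambda>a b. w a b z)"
            using Z(1) op1[of "Z u v" "Z i l" z] by (simp add: w_def lookup_add qq del: less_Z q_gt.simps ang_val.simps) }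
        { assume "\<eta> z + \<eta> (Z i l) + \<eta> (Z u v) < r + 1 - \<eta>s N"
          \<comment> \<open>Now the relation is used at \<open>N\<close> itself, and
            \<open>z\<close> acts afterwards.\<close>
          then have "lin_ext (A (Z i l)) (A (Z u v) N) =
            scale (tl_q L (Z i l) (Z u v)) (lin_ext (A (Z u v)) (A (Z i l) N))
             + op2 A (tl_ang L (bas (Z i l, Z u v))) (bas N)"
            using Z N by (intro rel) auto
          then have "lin_ext (A z) (lin_ext (A (Z i l)) (A (Z u v) N)) =
            scale (tl_q L (Z i l) (Z u v)) (lin_ext (A z) (lin_ext (A (Z u v)) (A (Z i l) N)))
             + lin_ext (A z) (op2 A (tl_ang L (bas (Z i l, Z u v))) (bas N))"
            by (simp add: lin_ext_add lin_ext_scale)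
          then show "w z (Z i l) (Z u v) = q_gt p q \<epsilon> (Z i l) (Z u v) * w z (Z u v) (Z i l)
              + ang_val p q \<epsilon> (Z i l) (Z u v) (\<lambda>a b. w z a b)"
            using Z(1) op2[of "Z u v" "Z i l" z] by (simp add: w_def lookup_add qq del: less_Z q_gt.simps ang_val.simps) }
      next
        fix i u l v
        assume "u < i" "i \<in> {1..n}" "u \<in> {1..n}" "v \<in> {1..m}" "l \<in> {1..m}" "v < l"
        then show "\<eta> (Z i v) + \<eta> (Z u l) < \<eta> (Z i l) + \<eta> (Z u v)"
          using deg_exchange[of u i v l] by (simp add: eta del: deg.simps)
      qed (use unit_inv[OF unit_p] unit_inv[OF unit_q] eps_square eps_commute xyz ord deg in auto)
      then show "Poly_Mapping.lookup (op2 A (tl_ang L (bas (x, y))) (A z N)) t = Poly_Mapping.lookup (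
         scale (tl_q L y z * tl_q L x z) (lin_ext (A z) (op2 A (tl_ang L (bas (x, y))) (bas N)))
         + scale (tl_q L y z) (op2 A (tl_ang L (bas (x, z))) (A y N))
         - scale (tl_q L x y) (lin_ext (A y) (op2 A (tl_ang L (bas (x, z))) (bas N)))
         + lin_ext (A x) (op2 A (tl_ang L (bas (y, z))) (bas N))
         - scale (tl_q L x y * tl_q L x z) (op2 A (tl_ang L (bas (y, z))) (A x N))) t"
        by (simp add: lookup_add lookup_minus op1 op2 qq ord zx)
    qed
  qed
qed

section \<open>The axioms of a basic T-Lie algebra\<close>

lemma linear_maps:
  "linear_map_on (free_on (B \<times> B)) (free_on (B \<times> B)) (tl_S L)"
  "linear_map_on (free_on (B \<times> B)) (free_on (B \<times> B)) (tl_ang L)"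
proof -
  show "linear_map_on (free_on (B \<times> B)) (free_on (B \<times> B)) (tl_S L)"
    unfolding Lpq_def by (auto simp: Lpq_S_def basis Lpq_def intro!: linear_map_on_lin_ext)
  have "tl_ang L = lin_ext (\<lambda>z. tl_ang L (bas z))"
    by (simp add: Lpq_def Lpq_ang_def)
  then show "linear_map_on (free_on (B \<times> B)) (free_on (B \<times> B)) (tl_ang L)"
    using linear_map_on_lin_ext[of "B \<times> B" "\<lambda>z. tl_ang L (bas z)" "B \<times> B"] ang_closed by auto
qed

lemma ang_lin_ext: "tl_ang L (lin_ext g t) = lin_ext (\<lambda>x. tl_ang L (g x)) t"
  and S_lin_ext: "tl_S L (lin_ext g t) = lin_ext (\<lambda>x. tl_S L (g x)) t"
  by (simp_all add: Lpq_def Lpq_ang_def Lpq_S_def lin_ext_comp)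

lemma ang_eq: "tl_ang L t = lin_ext (\<lambda>z. tl_ang L (bas z)) t"
  and S_eq: "tl_S L t = lin_ext (\<lambda>z. tl_S L (bas z)) t"
  by (simp_all flip: ang_lin_ext S_lin_ext)

lemma T_eq: "tl_T L t = tl_S L t + tl_ang L t"
  by (simp add: Lpq_def)

lemma S_involution: "t \<in> free_on (B \<times> B) \<Longrightarrow> tl_S L (tl_S L t) = t"
proof -
  assume t: "t \<in> free_on (B \<times> B)"
  have "tl_S L (tl_S L (bas z)) = bas z" if zB: "z \<in> B \<times> B" for z
  proof -
    obtain x y where z: "z = (x, y)" "x \<in> B" "y \<in> B" using zB by auto
    have "tl_S L (scale c (bas (y, x))) = scale c (tl_S L (bas (y, x)))" for c
      by (simp only: Lpq_def Lpq_S_def tlie.simps lin_ext_scale)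
    then show ?thesis using z q_inverse[of x y] by (simp add: S_bas scale_single)
  qed
  then have "lin_ext (\<lambda>z. tl_S L (tl_S L (bas z))) t = lin_ext bas t"
    using t by (intro lin_ext_cong) (auto dest: free_onD)
  then show ?thesis by (simp flip: S_lin_ext)
qed

lemma tens_span_basis:
  "x \<in> B \<Longrightarrow> y \<in> B \<Longrightarrow> bas (x, y) \<in> tens_span (tl_comp L (deg x)) (tl_comp L (deg y))"
  unfolding tens_span_def comp
  by (intro free_mod.span_base CollectI exI[of _ "bas x"] exI[of _ "bas y"]) simp

text \<open>On basis pairs the strict drop \<open>deg a + deg b < e1 + e2\<close> is the bound
  \<open>e1 + e2 - 1\<close>; the rest is linearity.\<close>

lemma ang_filtered:
  assumes "e1 \<ge> 1" "e2 \<ge> 1"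
  shows "tl_ang L ` tens_span (tl_comp L e1) (tl_comp L e2) \<subseteq>
    free_mod.span (\<Union>{tens_span (tl_comp L a) (tl_comp L b) | a b. 1 \<le> a \<and> 1 \<le> b \<and> a + b \<le> e1 + e2 - 1})"
    (is "_ \<subseteq> free_mod.span ?U")
proof
  fix s assume "s \<in> tl_ang L ` tens_span (tl_comp L e1) (tl_comp L e2)"
  then obtain t where t: "t \<in> free_on ({x \<in> B. deg x = e1} \<times> {x \<in> B. deg x = e2})" and s: "s = tl_ang L t"
    using tens_span_free_on unfolding comp by blast
  have gens: "bas (a, b) \<in> free_mod.span ?U" if "a \<in> B" "b \<in> B" "deg a + deg b < e1 + e2" for a b
  proof (rule free_mod.span_base, rule UnionI)
    show "bas (a, b) \<in> tens_span (tl_comp L (deg a)) (tl_comp L (deg b))"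
      using that by (intro tens_span_basis)
    show "tens_span (tl_comp L (deg a)) (tl_comp L (deg b)) \<in>
      {tens_span (tl_comp L a) (tl_comp L b) | a b. 1 \<le> a \<and> 1 \<le> b \<and> a + b \<le> e1 + e2 - 1}"
      using that deg_pos[of a] deg_pos[of b] by (intro CollectI exI[of _ "deg a"] exI[of _ "deg b"]) auto
  qed
  have "tl_ang L (bas z) \<in> free_mod.span ?U" if z: "z \<in> Poly_Mapping.keys t" for z
  proof -
    obtain x y where xy: "z = (x, y)" "x \<in> B" "y \<in> B" "deg x = e1" "deg y = e2"
      using free_onD[OF t z] by auto
    have "lin_ext bas (tl_ang L (bas z)) \<in> free_mod.span ?U"
      unfolding lin_ext_def
    proof (intro free_mod.span_sum free_mod.span_scale)
      fix c assume c: "c \<in> Poly_Mapping.keys (tl_ang L (bas z))"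
      then show "bas c \<in> free_mod.span ?U"
        using gens free_onD[OF ang_low[OF xy(2,3)], of c] xy by (cases c) auto
    qed
    then show ?thesis by simp
  qed
  then show "s \<in> free_mod.span ?U"
    unfolding s by (subst ang_eq) (auto simp: lin_ext_def intro!: free_mod.span_sum free_mod.span_scale)
qed

lemma S_zero: "tl_S L 0 = 0"
  by (subst S_eq) simp

text \<open>On basis pairs: for \<open>x < y\<close> the angle bracket was defined by this rule, for
  \<open>x > y\<close> a scalar cancels against its inverse, and on the diagonal the bracket is
  zero.\<close>

lemma ang_S: "t \<in> free_on (B \<times> B) \<Longrightarrow> tl_ang L (tl_S L t) = - tl_ang L t"
proof -
  assume t: "t \<in> free_on (B \<times> B)"
  have scale: "tl_ang L (scale c u) = scale c (tl_ang L u)" for c u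
    by (subst (1 2) ang_eq) (rule lin_ext_scale)
  have "tl_ang L (tl_S L (bas z)) = scale (- 1) (tl_ang L (bas z))" if zB: "z \<in> B \<times> B" for z
  proof -
    obtain x y where z: "z = (x, y)" "x \<in> B" "y \<in> B" using zB by auto
    have "tl_ang L (tl_S L (bas z)) = scale (Lpq_q p q \<epsilon> x y) (tl_ang L (bas (y, x)))"
      using z by (simp add: S_bas scale tl_q del: scale_bas)
    also have "\<dots> = scale (- 1) (tl_ang L (bas z))"
      using unit_inv[OF q_gt_unit[of y x]] unit_inv[OF q_gt_unit[of x y]] z
      by (cases x y rule: linorder_cases) (auto simp: ang_bas Lpq_q_def mult.commute)
    finally show ?thesis .
  qed
  then have "lin_ext (\<lambda>z. tl_ang L (tl_S L (bas z))) t = lin_ext (\<lambda>z. scale (- 1) (tl_ang L (bas z))) t"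
    using t by (intro lin_ext_cong) (auto dest: free_onD)
  moreover have "tl_ang L (tl_S L t) = lin_ext (\<lambda>z. tl_ang L (tl_S L (bas z))) t"
    by (simp flip: S_lin_ext ang_lin_ext)
  moreover have "lin_ext (\<lambda>z. scale (- 1) (tl_ang L (bas z))) t = - tl_ang L t"
    by (subst (2) ang_eq, subst scale_lin_ext[symmetric]) simp
  ultimately show ?thesis by simp
qed

text \<open>It reduces the compatibility of \<open>S\<close> with \<open>[,]\<close> and the Jacobi
  condition to \<open>0 = 0\<close>.\<close>

lemma bracket_maps_zero: "Id_br L t = 0" "br_Id L t = 0"
proof -
  have "lin_ext (\<lambda>z. 0 :: 'b \<Rightarrow>\<^sub>0 'k) t = 0" for t :: "'a \<Rightarrow>\<^sub>0 'k" by (simp add: lin_ext_def)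
  then show "Id_br L t = 0" "br_Id L t = 0"
    by (simp_all add: Id_br_def br_Id_def map_tens_def br_zero case_prod_unfold)
qed

lemma basic: "basic_T_Lie_algebra L"
  unfolding basic_T_Lie_algebra_def Let_def
proof (intro conjI ballI allI impI)
  show "linear_map_on (free_on (B \<times> B)) (free_on (B \<times> B)) (tl_T L)"
    using linear_maps unfolding linear_map_on_def T_eq
    by (auto simp: free_on_add free_mod.scale_right_distrib)
  show "linear_map_on (free_on (B \<times> B)) (free_on B) (tl_br L)"
    by (simp add: linear_map_on_def br_zero)
  show "direct_sum_decomp (free_on B) (tl_comp L)"
    unfolding comp by (rule direct_sum_decomp_free_on[OF deg_pos])
  show "\<exists>\<eta>\<ge>1. bas x \<in> tl_comp L \<eta>" if "x \<in> B" for x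
    using that deg_pos[OF that] unfolding comp by (intro exI[of _ "deg x"]) simp
  show "\<exists>q. tl_S L (bas (x, y)) = scale q (bas (y, x))" if "x \<in> B" "y \<in> B" for x y
    using S_bas[OF that] by blast
  show "tl_br L ` tens_span (tl_comp L e1) (tl_comp L e2) \<subseteq> free_mod.span (\<Union>{tl_comp L e | e. 1 \<le> e \<and> e \<le> e1 + e2 - 1})" for e1 e2
    by (auto simp: br_zero free_mod.span_zero)
  show "tl_ang L ` tens_span (tl_comp L e1) (tl_comp L e2) \<subseteq>
    free_mod.span (\<Union>{tens_span (tl_comp L a) (tl_comp L b) | a b. 1 \<le> a \<and> 1 \<le> b \<and> a + b \<le> e1 + e2 - 1})"
    if "1 \<le> e1" "1 \<le> e2" for e1 e2
    using that by (rule ang_filtered)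
  show "tl_T L t = tl_S L t + tl_ang L t" for t by (rule T_eq)
qed (simp_all add: linear_maps S_involution bracket_maps_zero S_zero br_zero ang_S)

end

theorem theorem9p3:
  fixes p q :: "'k::comm_ring_1"
    and \<epsilon> :: "nat \<Rightarrow> nat \<Rightarrow> 'k"
    and \<alpha> n m :: nat
  assumes "p dvd 1" and "q dvd 1" and "p * q \<noteq> 1"
    and "\<alpha> \<ge> 1"
    and "\<And>i j. 1 \<le> i \<Longrightarrow> i < j \<Longrightarrow> j \<le> \<alpha> \<Longrightarrow> \<epsilon> i j = 1 \<or> \<epsilon> i j = -1"
    and "\<And>i. 1 \<le> i \<Longrightarrow> i \<le> \<alpha> \<Longrightarrow> \<epsilon> i i = 1"
    and "\<And>i j. 1 \<le> i \<Longrightarrow> i < j \<Longrightarrow> j \<le> \<alpha> \<Longrightarrow> \<epsilon> j i = \<epsilon> i j"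
    and "1 \<le> m" and "m \<le> \<alpha>" and "1 \<le> n" and "n \<le> \<alpha>"
  shows "basic_T_Lie_algebra (Lpq p q \<epsilon> n m) \<and> adequate (Lpq p q \<epsilon> n m)"
proof -
  have range: "1 \<le> i \<and> i \<le> \<alpha>" if "i \<in> {1..n} \<union> {1..m}" for i
    using that assms(8-11) by auto
  have commute: "\<epsilon> i j = \<epsilon> j i" if "1 \<le> i \<and> i \<le> \<alpha>" "1 \<le> j \<and> j \<le> \<alpha>" for i j
    using assms(7)[of i j] assms(7)[of j i] that by (cases i j rule: linorder_cases) auto
  have sign: "\<epsilon> i j = 1 \<or> \<epsilon> i j = -1" if "1 \<le> i \<and> i \<le> \<alpha>" "1 \<le> j \<and> j \<le> \<alpha>" for i j
    using assms(5)[of i j] assms(5)[of j i] assms(6)[of i] commute[of i j] that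
    by (cases i j rule: linorder_cases) auto
  \<comment> \<open>In the zero ring \<open>p * q = 1\<close> would hold.\<close>
  have "(1 :: 'k) \<noteq> 0"
    using assms(3) by (metis mult_1_right mult_zero_right)
  then interpret Lpq_parameters p q \<epsilon> n m
    using assms(1,2) sign_square[OF sign] commute range by unfold_locales blast+
  show ?thesis using basic adequate by blast
qed

end
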